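(* Let $d\ge 1$ and $n\ge 1$ be integers, let $\mu$ be a Borel probability measure on $\mathbb R^d$, let $1\le r\le\infty$, and assume that $\mu^{*n}\in L^r(\mathbb R^d)$. Let $p$ satisfy $1\le p\le \frac{2n}{2n-1}$ if $r\ge 2$, and $1\le p\le \frac{nr'}{nr'-1}$ if $1\le r\le 2$. Let $1\le q\le \frac{p'}{nr'}$. Then there is a constant $C>0$, independent of $f$, such that $$\|\hat f\|_{L^q(\mu)}\le C\,\|f\|_{L^p(\mathbb R^d)}\qquad\text{for all } f\in\mathcal S(\mathbb R^d).$$
   Context: $\mathcal S(\mathbb R^d)$ is the Schwartz space and $\hat f(\xi)=\int_{\mathbb R^d}e^{-2\pi i\langle \xi,x\rangle}f(x)\,dx$, where $\langle\cdot,\cdot\rangle$ is the Euclidean inner product. $\mu^{*n}=\mu*\cdots*\mu$ denotes the $n$-fold convolution of $\mu$ with itself ($\mu^{*1}=\mu$). The hypothesis $\mu^{*n}\in L^r(\mathbb R^d)$ means that $\mu^{*n}$ is absolutely continuous with respect to Lebesgue measure, with density in $L^r(\mathbb R^d)$. For $1\le t\le\infty$, $t'$ is the conjugate exponent, $\frac1t+\frac1{t'}=1$, with $1'=\infty$ and $\infty'=1$. When $r=1$ (so $r'=\infty$), $\frac{nr'}{nr'-1}$ is read as $1$, forcing $p=1$. When $p=1$ (so $p'=\infty$), the upper bound $\frac{p'}{nr'}$ is read as $\infty$, with $q=\infty$ allowed; this includes the case $r=1$. *)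

theory Defs
  imports "HOL-Probability.Probability"
begin

text \<open>
  Exponents are extended nonnegative reals, so that \<open>\<infinity>\<close> is a regular exponent.  In \<open>ennreal\<close> we
  have \<open>inverse 0 = \<infinity>\<close> and \<open>inverse \<infinity> = 0\<close>, hence the definition below gives \<open>1' = \<infinity>\<close> and
  \<open>\<infinity>' = 1\<close>.
\<close>

definition conj_exp :: "ennreal \<Rightarrow> ennreal" where
  "conj_exp t = inverse (1 - inverse t)"

lemma conj_exp_1: "conj_exp 1 = \<infinity>"
  by (simp add: conj_exp_def)

lemma conj_exp_infinity: "conj_exp \<infinity> = 1"
  by (simp add: conj_exp_def)

lemma inverse_conj_exp:
  assumes "1 \<le> t"
  shows "inverse t + inverse (conj_exp t) = 1"
proof -
  have "1 / t \<le> 1"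
    by (rule divide_le_posI_ennreal) (use assms in \<open>auto intro: less_le_trans[OF zero_less_one]\<close>)
  then have "inverse t \<le> 1"
    by (simp add: divide_ennreal_def)
  moreover have "inverse (conj_exp t) = 1 - inverse t"
    using one_divide_one_divide_ennreal[of "1 - inverse t"]
    by (simp add: conj_exp_def divide_ennreal_def)
  ultimately show ?thesis
    by simp
qed

definition enn_root :: "real \<Rightarrow> ennreal \<Rightarrow> ennreal" where
  "enn_root p a = (if a = \<infinity> then \<infinity> else ennreal (enn2real a powr (1 / p)))"

definition Lp_norm :: "ennreal \<Rightarrow> 'a measure \<Rightarrow> ('a \<Rightarrow> 'b::real_normed_vector) \<Rightarrow> ennreal" where
  "Lp_norm p M f =
    (if p = \<infinity> then esssup M (\<lambda>x. ennreal (norm (f x)))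
     else enn_root (enn2real p) (\<integral>\<^sup>+ x. ennreal (norm (f x) powr enn2real p) \<partial>M))"

definition in_Lp :: "ennreal \<Rightarrow> 'a measure \<Rightarrow> ('a \<Rightarrow> 'b::real_normed_vector) \<Rightarrow> bool" where
  "in_Lp p M f \<longleftrightarrow> f \<in> borel_measurable M \<and> Lp_norm p M f < \<infinity>"

definition has_Lp_density :: "ennreal \<Rightarrow> 'a::euclidean_space measure \<Rightarrow> bool" where
  "has_Lp_density r \<nu> \<longleftrightarrow>
    (\<exists>g :: 'a \<Rightarrow> real. (\<forall>x. 0 \<le> g x) \<and> in_Lp r lborel g \<and> \<nu> = density lborel (\<lambda>x. ennreal (g x)))"

text \<open>Meaningful for \<open>n \<ge> 1\<close>; one convolution factor means \<open>\<mu>\<close> itself.\<close>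

definition conv_power :: "'a::ordered_euclidean_space measure \<Rightarrow> nat \<Rightarrow> 'a measure" where
  "conv_power \<mu> n = (convolution \<mu> ^^ (n - 1)) \<mu>"

text \<open>
  \<open>iter_partial [b\<^sub>1, \<dots>, b\<^sub>k] f\<close> is the partial derivative \<open>\<partial>\<^bsub>b\<^sub>1\<^esub> \<dots> \<partial>\<^bsub>b\<^sub>k\<^esub> f\<close> along standard basis
  vectors.  Lists of basis vectors play the role of multi-indices; \<open>frechet_derivative\<close> is
  only meaningful where the function is differentiable, which \<open>schwartz\<close> demands at every order.
\<close>

primrec iter_partial ::
  "'a::euclidean_space list \<Rightarrow> ('a \<Rightarrow> 'b::real_normed_vector) \<Rightarrow> 'a \<Rightarrow> 'b" where
  "iter_partial [] f = f"
| "iter_partial (b # bs) f = (\<lambda>x. frechet_derivative (iter_partial bs f) (at x) b)"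

definition schwartz :: "('a::euclidean_space \<Rightarrow> complex) \<Rightarrow> bool" where
  "schwartz f \<longleftrightarrow>
    (\<forall>bs. set bs \<subseteq> Basis \<longrightarrow>
       (\<forall>x. iter_partial bs f differentiable (at x)) \<and>
       (\<forall>k::nat. bounded (range (\<lambda>x. norm x ^ k *\<^sub>R iter_partial bs f x))))"

definition fourier :: "('a::euclidean_space \<Rightarrow> complex) \<Rightarrow> 'a \<Rightarrow> complex" where
  "fourier f \<xi> = (LINT x|lborel. exp (- 2 * of_real pi * \<i> * of_real (\<xi> \<bullet> x)) * f x)"

end

theory Submission
  imports Defs
begin

text \<open>
  Write \<open>\<rho> = r'\<close> and \<open>P = p'\<close>.  Since \<open>\<mu>\<close> is a probability measure only the largest exponent
  \<open>Q = P / (n * \<rho>)\<close> matters.  Let \<open>u\<close> be the positive part of \<open>Re (c * fourier f)\<close> with \<open>norm c = 1\<close>,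
  and put \<open>\<nu> = u powr (Q - 1) \<mu>\<close>.  By Fubini, \<open>\<integral> u powr Q d\<mu>\<close> is at most the integral of
  \<open>norm f\<close> times the modulus of the transform of \<open>\<nu>\<close>, so it suffices to bound the \<open>L\<^sup>P\<close> norm of that
  transform.  Its \<open>n\<close>-th power is the transform of the \<open>n\<close>-fold convolution power of \<open>\<nu>\<close>, whose density
  \<open>G\<close> is controlled by duality: iterating Hoelder's inequality over the \<open>n\<close> factors compares
  \<open>\<integral> \<phi> G\<close> with the integral of \<open>\<phi> powr Q\<close> against the \<open>n\<close>-fold convolution power of \<open>\<mu>\<close>, which has
  an \<open>L\<^sup>r\<close> density.  The Hausdorff-Young inequality for \<open>G\<close> with exponent \<open>Q * \<rho> = P / n \<ge> 2\<close>
  then closes the argument; \<open>Q * \<rho> \<ge> 2\<close> is what the upper bounds on \<open>p\<close> provide.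
\<close>

section \<open>Powers of extended nonnegative reals and Hoelder's inequality\<close>

text \<open>Top goes to top and 0 goes to 0 for every exponent, including exponent 0, since
  \<open>0 powr p = 0\<close> in HOL. Composition and multiplicativity therefore hold without side
  conditions.\<close>

definition epow :: "real \<Rightarrow> ennreal \<Rightarrow> ennreal" where
  "epow p a = (if a = \<infinity> then \<infinity> else ennreal (enn2real a powr p))"

lemma enn_root_eq_epow: "enn_root p = epow (1 / p)"
  by (simp add: fun_eq_iff enn_root_def epow_def)

lemma epow_top [simp]: "epow p \<infinity> = \<infinity>" "epow p top = top"
  by (simp_all add: epow_def)

lemma epow_0 [simp]: "epow p 0 = 0"
  by (simp add: epow_def)

lemma epow_ennreal [simp]: "0 \<le> x \<Longrightarrow> epow p (ennreal x) = ennreal (x powr p)"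
  by (simp add: epow_def)

lemma epow_one [simp]: "epow p 1 = 1"
  by (simp add: epow_def)

lemma epow_1 [simp]: "epow 1 a = a"
  by (cases a) auto

lemma measurable_epow [measurable]:
  assumes [measurable]: "f \<in> borel_measurable M"
  shows "(\<lambda>x. epow p (f x)) \<in> borel_measurable M"
  unfolding epow_def by measurable

lemma epow_mono: "0 \<le> p \<Longrightarrow> a \<le> b \<Longrightarrow> epow p a \<le> epow p b"
  by (cases a; cases b) (auto simp: top_unique intro!: powr_mono2 ennreal_leI)

lemma epow_epow: "epow p (epow q a) = epow (p * q) a"
  by (cases a) (auto simp: powr_powr mult.commute)

lemma epow_eq_0_iff [simp]: "epow p a = 0 \<longleftrightarrow> a = 0"
  by (cases a) auto

lemma epow_eq_top_iff [simp]: "epow p a = top \<longleftrightarrow> a = top"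
  by (cases a) auto

lemma epow_mult: "epow p (a * b) = epow p a * epow p b"
proof (cases "a = 0 \<or> b = 0 \<or> a = top \<or> b = top")
  case True
  then show ?thesis by (auto simp: ennreal_mult_eq_top_iff ennreal_top_mult ennreal_mult_top)
next
  case False
  then obtain x y where "a = ennreal x" "b = ennreal y" "0 \<le> x" "0 \<le> y"
    by (cases a; cases b) auto
  then show ?thesis
    by (simp add: ennreal_mult[symmetric] powr_mult)
qed

lemma epow_add:
  assumes "a \<noteq> top"
  shows "epow (p + q) a = epow p a * epow q a"
  using assms by (cases a) (auto simp: powr_add ennreal_mult)

lemma epow_le_iff:
  assumes "0 < p"
  shows "epow p a \<le> b \<longleftrightarrow> a \<le> epow (1 / p) b"
  using assms epow_mono[of "1 / p" "epow p a" b] epow_mono[of p a "epow (1 / p) b"]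
  by (auto simp: epow_epow)

lemma young_ennreal:
  assumes "1 < m"
  shows "a * b \<le> ennreal ((m - 1) / m) * epow (m / (m - 1)) a + ennreal (1 / m) * epow m b"
proof (cases "a = 0 \<or> b = 0 \<or> a = top \<or> b = top")
  case True
  with assms show ?thesis by (auto simp: ennreal_mult_top)
next
  case False
  then obtain x y where xy: "a = ennreal x" "b = ennreal y" "0 \<le> x" "0 \<le> y"
    by (cases a; cases b) auto
  have "x * y \<le> x powr (m / (m - 1)) / (m / (m - 1)) + y powr m / m"
    using assms xy by (intro Youngs_inequality) (auto simp: field_simps)
  then show ?thesis
    using xy assms
    by (auto simp: ennreal_mult[symmetric] ennreal_plus[symmetric] mult.commute simp del: ennreal_plus
        intro!: ennreal_leI)
qed

text \<open>Young's inequality is integrated after both functions are scaled to norm one; the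
  degenerate values 0 and top are split off first. Raising the result to the power \<open>m\<close>
  gives the shape that can be iterated over convolution factors.\<close>

lemma hoelder_nn_integral:
  assumes m: "1 < m"
    and [measurable]: "w \<in> borel_measurable M" "\<phi> \<in> borel_measurable M"
  shows "epow m (\<integral>\<^sup>+x. w x * \<phi> x \<partial>M)
    \<le> epow (m - 1) (\<integral>\<^sup>+x. epow (m / (m - 1)) (w x) \<partial>M) * (\<integral>\<^sup>+x. epow m (\<phi> x) \<partial>M)"
    (is "epow m ?I \<le> epow _ ?W * ?P")
proof -
  consider "?W = 0" | "?P = 0" | "?W = top" "?P \<noteq> 0" | "?P = top" "?W \<noteq> 0"
    | "?W \<noteq> 0" "?P \<noteq> 0" "?W \<noteq> top" "?P \<noteq> top"
    by blast
  then show ?thesis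
  proof cases
    case 1
    then have "AE x in M. w x = 0" by (simp add: nn_integral_0_iff_AE)
    then have "?I = 0" by (subst nn_integral_0_iff_AE) auto
    then show ?thesis by simp
  next
    case 2
    then have "AE x in M. \<phi> x = 0" by (simp add: nn_integral_0_iff_AE)
    then have "?I = 0" by (subst nn_integral_0_iff_AE) auto
    then show ?thesis by simp
  next
    case 3 then show ?thesis by (simp add: ennreal_top_mult)
  next
    case 4 then show ?thesis by (simp add: ennreal_mult_top)
  next
    case 5
    define W where "W = enn2real ?W"
    define P where "P = enn2real ?P"
    have W: "?W = ennreal W" "0 < W" and P: "?P = ennreal P" "0 < P"
      using 5 by (auto simp: W_def P_def enn2real_positive_iff less_top zero_less_iff_neq_zero)
    \<comment> \<open>Normalising constants: \<open>a * w\<close> has norm one for the exponent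
      \<open>m / (m - 1)\<close>, and \<open>b * \<phi>\<close> has norm one for
      \<open>m\<close>.\<close>
    define a where "a = W powr - ((m - 1) / m)"
    define b where "b = P powr - (1 / m)"
    have ab: "0 < a" "0 < b" using W P by (auto simp: a_def b_def)
    have apow: "a powr (m / (m - 1)) = 1 / W" and bpow: "b powr m = 1 / P"
    proof -
      have e: "- ((m - 1) / m) * (m / (m - 1)) = - 1" "- (1 / m) * m = - 1"
        using m by (simp_all add: field_simps)
      show "a powr (m / (m - 1)) = 1 / W" "b powr m = 1 / P"
        unfolding a_def b_def powr_powr e using W(2) P(2) by (simp_all add: powr_minus_divide)
    qed
    have "ennreal (a * b) * ?I = (\<integral>\<^sup>+x. (ennreal a * w x) * (ennreal b * \<phi> x) \<partial>M)"
      using ab by (subst nn_integral_cmult[symmetric]) (auto simp: ennreal_mult mult_ac)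
    also have "\<dots> \<le> (\<integral>\<^sup>+x. ennreal ((m - 1) / m) * epow (m / (m - 1)) (ennreal a * w x)
        + ennreal (1 / m) * epow m (ennreal b * \<phi> x) \<partial>M)"
      by (intro nn_integral_mono young_ennreal m)
    also have "\<dots> = ennreal ((m - 1) / m) * (ennreal (1 / W) * ?W) + ennreal (1 / m) * (ennreal (1 / P) * ?P)"
      using ab by (simp add: epow_mult nn_integral_add nn_integral_cmult apow bpow)
    also have "\<dots> = 1"
      using W P m by (simp add: ennreal_mult[symmetric] ennreal_plus[symmetric] add_divide_distrib[symmetric] del: ennreal_plus)
    finally have le: "ennreal (a * b) * ?I \<le> 1" .
    have "?I = ennreal (1 / (a * b)) * (ennreal (a * b) * ?I)"
      using ab by (simp add: mult.assoc[symmetric] ennreal_mult[symmetric])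
    also have "\<dots> \<le> ennreal (1 / (a * b)) * 1"
      using le by (intro mult_left_mono) auto
    finally have "epow m ?I \<le> epow m (ennreal (1 / (a * b)))"
      using m by (intro epow_mono) auto
    also have "\<dots> = ennreal (W powr (m - 1) * P)"
    proof -
      have "1 / (a * b) = W powr ((m - 1) / m) * P powr (1 / m)"
        by (simp add: a_def b_def powr_minus_divide)
      moreover have "(m - 1) / m * m = m - 1" "1 / m * m = 1" using m by auto
      ultimately have "(1 / (a * b)) powr m = W powr (m - 1) * P"
        using P(2) by (simp add: powr_mult powr_powr del: times_divide_eq_left)
      then show ?thesis using ab by simp
    qed
    also have "\<dots> = epow (m - 1) ?W * ?P"
      using W P by (simp add: ennreal_mult)
    finally show ?thesis .
  qed
qed

section \<open>Convolution powers and their Fourier transforms\<close>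

lemma sets_conv_power: "sets M = sets borel \<Longrightarrow> sets (conv_power M n) = sets borel"
  by (cases "n - 1") (simp_all add: conv_power_def)

lemma conv_power_1 [simp]: "conv_power M (Suc 0) = M"
  by (simp add: conv_power_def)

lemma conv_power_Suc: "1 \<le> n \<Longrightarrow> conv_power M (Suc n) = convolution M (conv_power M n)"
  by (cases n) (simp_all add: conv_power_def)

lemma finite_measure_conv_power:
  assumes "finite_measure M" "sets M = sets borel" "1 \<le> n"
  shows "finite_measure (conv_power M n)"
  using assms(3)
  by (induction n rule: dec_induct)
    (simp_all add: assms conv_power_Suc convolution_finite sets_conv_power)

text \<open>Iterated Hoelder. Peel off one convolution factor: the integral over the remaining
  factors, as a function of \<open>x\<close>, is a test function for \<open>H\<close>, and the
  induction hypothesis then applies to each translate of \<open>\<phi>\<close>. Every factor costs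
  one \<open>K\<close>.\<close>

lemma conv_power_density_nn_integral_le:
  fixes \<mu> :: "'a::ordered_euclidean_space measure"
  assumes \<mu>: "finite_measure \<mu>" "sets \<mu> = sets borel"
    and \<nu>: "finite_measure (density \<mu> g)" "g \<in> borel_measurable borel"
    and H: "\<And>\<phi>. \<phi> \<in> borel_measurable borel \<Longrightarrow>
      epow q (\<integral>\<^sup>+x. g x * \<phi> x \<partial>\<mu>) \<le> K * (\<integral>\<^sup>+x. epow q (\<phi> x) \<partial>\<mu>)"
    and q: "0 \<le> q" and n: "1 \<le> n"
    and \<phi>: "\<phi> \<in> borel_measurable borel"
  shows "epow q (\<integral>\<^sup>+x. \<phi> x \<partial>conv_power (density \<mu> g) n)
    \<le> K ^ n * (\<integral>\<^sup>+x. epow q (\<phi> x) \<partial>conv_power \<mu> n)"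
  using n \<phi>
proof (induction n arbitrary: \<phi> rule: dec_induct)
  case base
  note [measurable] = base \<nu>(2) and [measurable_cong] = \<mu>(2)
  show ?case using H[OF base] by (simp add: nn_integral_density)
next
  case (step n)
  note [measurable] = step.prems \<nu>(2) and [measurable_cong] = \<mu>(2)
  let ?\<nu> = "density \<mu> g"
  let ?\<nu>n = "conv_power ?\<nu> n" and ?\<mu>n = "conv_power \<mu> n"
  have s: "sets ?\<nu> = sets borel" using \<mu>(2) by simp
  have sn [measurable_cong]: "sets ?\<nu>n = sets borel" "sets ?\<mu>n = sets borel"
    using s \<mu>(2) by (simp_all add: sets_conv_power)
  interpret \<nu>n: finite_measure ?\<nu>n
    using finite_measure_conv_power \<nu>(1) s step.hyps by blast
  interpret \<mu>n: finite_measure ?\<mu>n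
    using finite_measure_conv_power \<mu> step.hyps by blast
  have "(\<integral>\<^sup>+x. \<phi> x \<partial>conv_power ?\<nu> (Suc n)) = (\<integral>\<^sup>+x. \<integral>\<^sup>+y. \<phi> (x + y) \<partial>?\<nu>n \<partial>?\<nu>)"
    using step.hyps sn s \<nu>(1) \<nu>n.finite_measure_axioms
    by (simp add: conv_power_Suc nn_integral_convolution)
  also have "\<dots> = (\<integral>\<^sup>+x. g x * (\<integral>\<^sup>+y. \<phi> (x + y) \<partial>?\<nu>n) \<partial>\<mu>)"
    by (subst nn_integral_density) measurable
  finally have "epow q (\<integral>\<^sup>+x. \<phi> x \<partial>conv_power ?\<nu> (Suc n))
      \<le> K * (\<integral>\<^sup>+x. epow q (\<integral>\<^sup>+y. \<phi> (x + y) \<partial>?\<nu>n) \<partial>\<mu>)"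
    by (simp add: H)
  also have "\<dots> \<le> K * (\<integral>\<^sup>+x. K ^ n * (\<integral>\<^sup>+y. epow q (\<phi> (x + y)) \<partial>?\<mu>n) \<partial>\<mu>)"
    by (intro mult_left_mono nn_integral_mono step.IH) auto
  also have "\<dots> = K ^ Suc n * (\<integral>\<^sup>+x. \<integral>\<^sup>+y. epow q (\<phi> (x + y)) \<partial>?\<mu>n \<partial>\<mu>)"
    by (subst nn_integral_cmult) (auto simp: mult.assoc)
  also have "(\<integral>\<^sup>+x. \<integral>\<^sup>+y. epow q (\<phi> (x + y)) \<partial>?\<mu>n \<partial>\<mu>) = (\<integral>\<^sup>+x. epow q (\<phi> x) \<partial>conv_power \<mu> (Suc n))"
    using step.hyps sn \<mu> \<mu>n.finite_measure_axioms
    by (simp add: conv_power_Suc nn_integral_convolution)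
  finally show ?case .
qed

section \<open>Characters, Fourier transforms of measures, and Fubini for bounded kernels\<close>

definition cis2pi :: "real \<Rightarrow> complex" where
  "cis2pi t = exp (- 2 * of_real pi * \<i> * of_real t)"

lemma cis2pi_eq_cis: "cis2pi t = cis (- 2 * pi * t)"
  by (simp add: cis2pi_def cis_conv_exp algebra_simps)

lemma norm_cis2pi [simp]: "norm (cis2pi t) = 1"
  by (simp add: cis2pi_eq_cis)

lemma cis2pi_add: "cis2pi (s + t) = cis2pi s * cis2pi t"
  by (simp add: cis2pi_eq_cis cis_mult algebra_simps)

lemma measurable_cis2pi [measurable]:
  assumes [measurable]: "f \<in> borel_measurable M"
  shows "(\<lambda>x. cis2pi (f x)) \<in> borel_measurable M"
  unfolding cis2pi_def by measurable

lemma fourier_eq: "fourier f \<xi> = (LINT x|lborel. cis2pi (\<xi> \<bullet> x) * f x)"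
  by (simp add: fourier_def cis2pi_def)

definition fourier_measure :: "'a::euclidean_space measure \<Rightarrow> 'a \<Rightarrow> complex" where
  "fourier_measure M x = (LINT \<xi>|M. cis2pi (x \<bullet> \<xi>))"

text \<open>A character turns the sum of the two variables into a product; Fubini applies because
  the integrand is bounded and both measures are finite.\<close>

lemma fourier_measure_convolution:
  fixes M N :: "'a::ordered_euclidean_space measure"
  assumes M: "finite_measure M" "sets M = sets borel"
    and N: "finite_measure N" "sets N = sets borel"
  shows "fourier_measure (convolution M N) x = fourier_measure M x * fourier_measure N x"
proof -
  note [measurable_cong] = M(2) N(2)
  interpret M: finite_measure M by fact
  interpret N: finite_measure N by fact
  interpret pair_sigma_finite M N ..
  have "finite_measure (M \<Otimes>\<^sub>M N)" by (intro finite_measure_pair_measure M N)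
  then interpret MN: finite_measure "M \<Otimes>\<^sub>M N" .
  have "fourier_measure (convolution M N) x
      = (LINT p|(M \<Otimes>\<^sub>M N). cis2pi (x \<bullet> fst p) * cis2pi (x \<bullet> snd p))"
    unfolding fourier_measure_def convolution_def
    by (subst integral_distr) (auto simp: inner_add_right cis2pi_add split_beta')
  also have "\<dots> = (LINT \<xi>|M. LINT \<eta>|N. cis2pi (x \<bullet> \<xi>) * cis2pi (x \<bullet> \<eta>))"
    by (subst integral_fst'[symmetric])
      (auto intro!: MN.integrable_const_bound[where B=1] simp: norm_mult)
  also have "\<dots> = fourier_measure M x * fourier_measure N x"
    by (simp add: fourier_measure_def)
  finally show ?thesis .
qed

lemma fourier_measure_conv_power:
  assumes "finite_measure M" "sets M = sets borel" "1 \<le> n"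
  shows "fourier_measure (conv_power M n) x = fourier_measure M x ^ n"
  using assms(3)
  by (induction n rule: dec_induct)
    (simp_all add: assms conv_power_Suc fourier_measure_convolution finite_measure_conv_power sets_conv_power)

lemma fourier_measure_density_lborel:
  assumes "G \<in> borel_measurable borel" "\<And>x. 0 \<le> G x"
  shows "fourier_measure (density lborel (\<lambda>x. ennreal (G x))) \<xi> = fourier (\<lambda>x. complex_of_real (G x)) \<xi>"
  using assms unfolding fourier_measure_def fourier_eq
  by (subst integral_density) (auto simp: scaleR_conv_of_real mult.commute)

text \<open>The integrable product \<open>a x * b y\<close> dominates the integrand. This covers the
  two exchanges behind Plancherel and the one that moves the Fourier transform from \<open>f\<close>
  to a measure.\<close>

lemma integral_bounded_kernel_swap:
  fixes a :: "'a \<Rightarrow> complex" and b :: "'b \<Rightarrow> complex"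
  assumes "sigma_finite_measure M" "sigma_finite_measure N"
    and a: "integrable M a" and b: "integrable N b"
    and k [measurable]: "(\<lambda>(x, y). k x y) \<in> borel_measurable (M \<Otimes>\<^sub>M N)"
    and k_le: "\<And>x y. norm (k x y) \<le> 1"
  shows "(LINT x|M. a x * (LINT y|N. k x y * b y)) = (LINT y|N. (LINT x|M. a x * k x y) * b y)"
proof -
  interpret M: sigma_finite_measure M by fact
  interpret N: sigma_finite_measure N by fact
  interpret pair_sigma_finite M N ..
  have [measurable]: "a \<in> borel_measurable M" "b \<in> borel_measurable N" using a b by auto
  have "integrable (M \<Otimes>\<^sub>M N) (\<lambda>(x, y). a x * b y)"
  proof (rule Fubini_integrable)
    show "integrable M (\<lambda>x. LINT y|N. norm (case (x, y) of (x, y) \<Rightarrow> a x * b y))"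
      using a by (simp add: norm_mult)
    show "AE x in M. integrable N (\<lambda>y. case (x, y) of (x, y) \<Rightarrow> a x * b y)"
      using b by simp
  qed simp
  then have int: "integrable (M \<Otimes>\<^sub>M N) (\<lambda>(x, y). a x * k x y * b y)"
    by (rule Bochner_Integration.integrable_bound)
      (auto simp: norm_mult mult_left_le_one_le mult.commute[of "norm (a _)"] mult.assoc k_le)
  have "(LINT x|M. a x * (LINT y|N. k x y * b y)) = (LINT x|M. LINT y|N. a x * k x y * b y)"
    by (simp add: mult.assoc)
  also have "\<dots> = (LINT y|N. LINT x|M. a x * k x y * b y)"
    using Fubini_integral[OF int] by simp
  also have "\<dots> = (LINT y|N. (LINT x|M. a x * k x y) * b y)"
    by simp
  finally show ?thesis .
qed

section \<open>Densities of convolution powers; the Gaussian kernel\<close>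

text \<open>Fatou's lemma, used to remove a truncation level and a Gaussian weight.\<close>

lemma nn_integral_le_of_tendsto:
  fixes u :: "nat \<Rightarrow> 'a \<Rightarrow> ennreal"
  assumes [measurable]: "\<And>N. u N \<in> borel_measurable M"
    and lim: "\<And>x. (\<lambda>N. u N x) \<longlonglongrightarrow> f x"
    and le: "\<And>N. (\<integral>\<^sup>+x. u N x \<partial>M) \<le> C"
  shows "(\<integral>\<^sup>+x. f x \<partial>M) \<le> C"
proof -
  have "(\<integral>\<^sup>+x. f x \<partial>M) = (\<integral>\<^sup>+x. liminf (\<lambda>N. u N x) \<partial>M)"
    using lim_imp_Liminf[OF _ lim] by (intro nn_integral_cong) (simp add: trivial_limit_sequentially)
  also have "\<dots> \<le> liminf (\<lambda>N. \<integral>\<^sup>+x. u N x \<partial>M)"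
    by (rule nn_integral_liminf) simp
  also have "\<dots> \<le> limsup (\<lambda>N. \<integral>\<^sup>+x. u N x \<partial>M)"
    by (rule Liminf_le_Limsup) simp
  also have "\<dots> \<le> C"
    by (rule Limsup_bounded) (simp add: le)
  finally show ?thesis .
qed

text \<open>The test function is a power of the truncation of \<open>G\<close>, which makes the quantity to be
  absorbed finite.\<close>

lemma Lp_bound_by_duality:
  fixes G :: "'a \<Rightarrow> real"
  assumes m: "1 < m"
    and G: "integrable M G" "\<And>x. 0 \<le> G x"
    and H: "\<And>\<phi>. \<phi> \<in> borel_measurable M \<Longrightarrow>
      epow m (\<integral>\<^sup>+x. \<phi> x * ennreal (G x) \<partial>M) \<le> D * (\<integral>\<^sup>+x. epow m (\<phi> x) \<partial>M)"
  shows "epow (m - 1) (\<integral>\<^sup>+x. ennreal (G x powr (m / (m - 1))) \<partial>M) \<le> D"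
proof -
  have [measurable]: "G \<in> borel_measurable M" using G by auto
  define s where "s = m / (m - 1)"
  have s: "0 < s - 1" "(s - 1) * m = s" using m by (auto simp: s_def field_simps)
  have fin: "(\<integral>\<^sup>+x. ennreal (G x) \<partial>M) < top"
    using G by (simp add: nn_integral_eq_integral)
  have trunc: "(\<integral>\<^sup>+x. ennreal (min (G x) (real N) powr s) \<partial>M) \<le> epow (1 / (m - 1)) D" for N
  proof -
    define X where "X = (\<integral>\<^sup>+x. ennreal (min (G x) (real N) powr s) \<partial>M)"
    define \<phi> where "\<phi> x = ennreal (min (G x) (real N) powr (s - 1))" for x
    have [measurable]: "\<phi> \<in> borel_measurable M" unfolding \<phi>_def by measurable
    have pw: "ennreal (min (G x) (real N) powr s) \<le> \<phi> x * ennreal (G x)" for x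
    proof -
      have "min (G x) (real N) powr s = min (G x) (real N) powr (s - 1) * min (G x) (real N)"
        using powr_add[of "min (G x) (real N)" "s - 1" 1] G(2)[of x] by simp
      also have "\<dots> \<le> min (G x) (real N) powr (s - 1) * G x"
        by (intro mult_left_mono) auto
      finally show ?thesis using G(2) by (simp add: \<phi>_def ennreal_mult[symmetric] ennreal_leI)
    qed
    have X_le: "X \<le> (\<integral>\<^sup>+x. \<phi> x * ennreal (G x) \<partial>M)"
      unfolding X_def by (intro nn_integral_mono pw)
    \<comment> \<open>A crude bound that only serves finiteness: the test function is at most
      \<open>real N powr (s - 1)\<close> and \<open>G\<close> is integrable.\<close>
    also have "\<dots> \<le> (\<integral>\<^sup>+x. ennreal (real N powr (s - 1)) * ennreal (G x) \<partial>M)"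
      unfolding \<phi>_def using G(2) s
      by (intro nn_integral_mono mult_right_mono ennreal_leI powr_mono2) auto
    also have "\<dots> = ennreal (real N powr (s - 1)) * (\<integral>\<^sup>+x. ennreal (G x) \<partial>M)"
      by (rule nn_integral_cmult) simp
    also have "\<dots> < top" using fin by (simp add: ennreal_mult_less_top)
    finally have "X < top" .
    have "epow m X \<le> epow m (\<integral>\<^sup>+x. \<phi> x * ennreal (G x) \<partial>M)"
      using X_le m by (intro epow_mono) auto
    also have "\<dots> \<le> D * (\<integral>\<^sup>+x. epow m (\<phi> x) \<partial>M)" by (rule H) simp
    \<comment> \<open>Since \<open>(s - 1) * m = s\<close>, the \<open>m\<close>-th power of the
      test function is the integrand of \<open>X\<close> itself.\<close>
    also have "(\<integral>\<^sup>+x. epow m (\<phi> x) \<partial>M) = X"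
      unfolding X_def \<phi>_def using s by (simp add: powr_powr)
    finally have XD: "epow m X \<le> D * X" .
    \<comment> \<open>One factor \<open>X\<close> is cancelled from \<open>XD\<close>, which is
      legitimate because \<open>X\<close> is finite.\<close>
    have "epow (m - 1) X \<le> D"
    proof (cases "X = 0 \<or> D = top")
      case False
      then obtain x d where x: "X = ennreal x" "0 < x" and d: "D = ennreal d" "0 \<le> d"
        using \<open>X < top\<close> by (cases X; cases D) auto
      have "x powr m \<le> d * x"
        using XD x d by (simp add: ennreal_mult[symmetric])
      moreover have "x powr m = x powr (m - 1) * x"
        using powr_add[of x "m - 1" 1] x by simp
      ultimately have "x powr (m - 1) \<le> d" using x by simp
      then show ?thesis using x d by (simp add: ennreal_leI)
    qed auto
    then show ?thesis using m by (simp add: epow_le_iff X_def)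
  qed
  have "(\<integral>\<^sup>+x. ennreal (G x powr s) \<partial>M) \<le> epow (1 / (m - 1)) D"
  proof (rule nn_integral_le_of_tendsto[OF _ _ trunc])
    fix x
    have "eventually (\<lambda>N. G x \<le> real N) sequentially"
      by (meson eventually_at_top_linorder nle_le of_nat_le_iff order_trans real_nat_ceiling_ge)
    then have "eventually (\<lambda>N. ennreal (min (G x) (real N) powr s) = ennreal (G x powr s)) sequentially"
      by eventually_elim simp
    then show "(\<lambda>N. ennreal (min (G x) (real N) powr s)) \<longlonglongrightarrow> ennreal (G x powr s)"
      by (rule tendsto_eventually)
  qed simp
  then show ?thesis using m by (simp add: epow_le_iff s_def)
qed

text \<open>Testing the iterated Hoelder bound on the indicator of a Lebesgue null set transfers
  absolute continuity from the power of \<open>\<mu>\<close> to that of the weighted measure.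
  Radon-Nikodym gives a density, and finiteness of the measure makes it finite almost everywhere,
  hence replaceable by a real function.\<close>

lemma conv_power_has_density:
  fixes \<mu> :: "'a::ordered_euclidean_space measure"
  assumes \<mu>: "finite_measure \<mu>" "sets \<mu> = sets borel"
    and \<nu>: "finite_measure (density \<mu> g)" "g \<in> borel_measurable borel"
    and H: "\<And>\<phi>. \<phi> \<in> borel_measurable borel \<Longrightarrow>
      epow q (\<integral>\<^sup>+x. g x * \<phi> x \<partial>\<mu>) \<le> K * (\<integral>\<^sup>+x. epow q (\<phi> x) \<partial>\<mu>)"
    and q: "0 \<le> q" and n: "1 \<le> n"
    and ac: "absolutely_continuous lborel (conv_power \<mu> n)"
  obtains G :: "'a \<Rightarrow> real" where "integrable lborel G" "\<And>x. 0 \<le> G x"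
    "conv_power (density \<mu> g) n = density lborel (\<lambda>x. ennreal (G x))"
proof -
  let ?N = "conv_power (density \<mu> g) n"
  have sN: "sets ?N = sets borel" "sets (conv_power \<mu> n) = sets borel"
    using \<mu> by (simp_all add: sets_conv_power)
  interpret N: finite_measure ?N
    using \<nu>(1) \<mu>(2) n by (intro finite_measure_conv_power) auto
  have "absolutely_continuous lborel ?N"
    unfolding absolutely_continuous_def
  proof
    fix A :: "'a set" assume A: "A \<in> null_sets lborel"
    then have [measurable]: "A \<in> sets borel" by auto
    have "A \<in> null_sets (conv_power \<mu> n)" using A ac by (auto simp: absolutely_continuous_def)
    then have 0: "emeasure (conv_power \<mu> n) A = 0" by auto
    have ind: "(\<lambda>x. epow q (indicator A x)) = indicator A"
      by (auto simp: fun_eq_iff indicator_def)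
    have "epow q (\<integral>\<^sup>+x. indicator A x \<partial>?N) \<le> K ^ n * (\<integral>\<^sup>+x. epow q (indicator A x) \<partial>conv_power \<mu> n)"
      by (rule conv_power_density_nn_integral_le[OF \<mu> \<nu> H q n]) auto
    then have "emeasure ?N A = 0"
      unfolding ind using sN 0 by simp
    then show "A \<in> null_sets ?N" using sN by (auto simp: null_sets_def)
  qed
  then obtain f where [measurable]: "f \<in> borel_measurable lborel" and f: "density lborel f = ?N"
    using sigma_finite_measure.Radon_Nikodym[OF sigma_finite_lborel, of ?N] sN by auto
  have "(\<integral>\<^sup>+x. f x \<partial>lborel) = emeasure ?N (space ?N)"
    by (simp add: f[symmetric] emeasure_density)
  then have fin: "(\<integral>\<^sup>+x. f x \<partial>lborel) < top" by (simp add: less_top[symmetric])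
  then have "AE x in lborel. f x \<noteq> \<infinity>"
    by (intro nn_integral_PInf_AE) auto
  then have eq: "AE x in lborel. f x = ennreal (enn2real (f x))"
    by eventually_elim (simp add: less_top)
  show thesis
  proof
    show "integrable lborel (\<lambda>x. enn2real (f x))"
      using fin nn_integral_cong_AE[OF eq] by (intro integrableI_nonneg) auto
    show "?N = density lborel (\<lambda>x. ennreal (enn2real (f x)))"
      unfolding f[symmetric] by (rule density_cong[OF _ _ eq]) auto
  qed simp
qed

section \<open>The Gaussian weight and its Fourier transform\<close>

text \<open>The substitution \<open>x = c * t\<close> reduces the integral to the characteristic
  function of the standard normal distribution. The result is again a probability density, of
  standard deviation \<open>c / (2 * pi)\<close>.\<close>

lemma gaussian_integral_real:
  assumes c: "0 < c"
  shows "integrable lborel (\<lambda>t. complex_of_real (exp (- (c\<^sup>2 * t\<^sup>2) / 2)))"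
    and "(LINT t|lborel. cis2pi (t * u) * complex_of_real (exp (- (c\<^sup>2 * t\<^sup>2) / 2)))
      = complex_of_real (normal_density 0 (c / (2 * pi)) u)"
proof -
  let ?g = "\<lambda>x. complex_of_real (std_normal_density x) * iexp (- 2 * pi * u / c * x)"
  have dens: "std_normal_density (c * t) = exp (- (c\<^sup>2 * t\<^sup>2) / 2) / sqrt (2 * pi)" for t
    by (simp add: normal_density_def power_mult_distrib)
  have "integrable lborel (\<lambda>t. std_normal_density (0 + c * t))"
    using c by (intro lborel_integrable_real_affine) auto
  then have "integrable lborel (\<lambda>t. sqrt (2 * pi) * std_normal_density (c * t))"
    by simp
  then show "integrable lborel (\<lambda>t. complex_of_real (exp (- (c\<^sup>2 * t\<^sup>2) / 2)))"
    unfolding dens by simp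
  have "(LINT x|lborel. ?g x) = char std_normal_distribution (- 2 * pi * u / c)"
    unfolding char_def by (subst integral_density) (auto simp: scaleR_conv_of_real)
  also have "\<dots> = complex_of_real (exp (- (2 * pi * u / c)\<^sup>2 / 2))"
    by (simp add: char_std_normal_distribution)
  finally have 1: "(LINT x|lborel. ?g x) = complex_of_real (exp (- (2 * pi * u / c)\<^sup>2 / 2))" .
  have "(LINT x|lborel. ?g x) = c *\<^sub>R (LINT t|lborel. ?g (0 + c * t))"
    using lborel_integral_real_affine[of c ?g 0] c by simp
  also have "(\<lambda>t. ?g (0 + c * t)) = (\<lambda>t. complex_of_real (1 / sqrt (2 * pi)) *
      (cis2pi (t * u) * complex_of_real (exp (- (c\<^sup>2 * t\<^sup>2) / 2))))"
    unfolding add_0 dens using c by (auto simp: cis2pi_def fun_eq_iff algebra_simps)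
  finally have "(LINT t|lborel. cis2pi (t * u) * complex_of_real (exp (- (c\<^sup>2 * t\<^sup>2) / 2)))
      = complex_of_real (sqrt (2 * pi) / c) * (LINT x|lborel. ?g x)"
    using c by (simp add: scaleR_conv_of_real)
  also have "\<dots> = complex_of_real (sqrt (2 * pi) / c * exp (- (2 * pi * u / c)\<^sup>2 / 2))"
    unfolding 1 by simp
  also have "sqrt (2 * pi) / c * exp (- (2 * pi * u / c)\<^sup>2 / 2) = normal_density 0 (c / (2 * pi)) u"
  proof -
    have "2 * pi * (c / (2 * pi))\<^sup>2 = (c / sqrt (2 * pi))\<^sup>2"
      using c by (simp add: power_divide power2_eq_square field_simps)
    then have "sqrt (2 * pi * (c / (2 * pi))\<^sup>2) = c / sqrt (2 * pi)"
      using c by simp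
    moreover have "- (2 * pi * u / c)\<^sup>2 / 2 = - u\<^sup>2 / (2 * (c / (2 * pi))\<^sup>2)"
      using c by (simp add: power_divide power2_eq_square field_simps)
    ultimately show ?thesis by (simp add: normal_density_def)
  qed
  finally show "(LINT t|lborel. cis2pi (t * u) * complex_of_real (exp (- (c\<^sup>2 * t\<^sup>2) / 2)))
      = complex_of_real (normal_density 0 (c / (2 * pi)) u)" .
qed

text \<open>Lebesgue measure is the image of a product of one-dimensional Lebesgue measures indexed
  by the basis, where integrals of products factor.\<close>

lemma lborel_integral_prod:
  fixes f :: "'a::euclidean_space \<Rightarrow> real \<Rightarrow> complex"
  assumes "\<And>b. b \<in> Basis \<Longrightarrow> integrable lborel (f b)"
  shows "integrable lborel (\<lambda>x. \<Prod>b\<in>Basis. f b (x \<bullet> b))"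
    and "(LINT x|lborel. (\<Prod>b\<in>Basis. f b (x \<bullet> b))) = (\<Prod>b\<in>Basis. integral\<^sup>L lborel (f b))"
proof -
  interpret product_sigma_finite "\<lambda>_::'a. lborel :: real measure" ..
  have [measurable]: "\<And>b. b \<in> Basis \<Longrightarrow> f b \<in> borel_measurable borel"
    using assms by auto
  have inner: "(\<Sum>b\<in>Basis. h b *\<^sub>R b) \<bullet> i = h i" if "i \<in> Basis" for h and i :: 'a
    using that by simp
  show "integrable lborel (\<lambda>x. \<Prod>b\<in>Basis. f b (x \<bullet> b))"
    by (subst lborel_eq, subst integrable_distr_eq)
      (auto simp: inner product_integrable_prod assms cong: prod.cong)
  show "(LINT x|lborel. (\<Prod>b\<in>Basis. f b (x \<bullet> b))) = (\<Prod>b\<in>Basis. integral\<^sup>L lborel (f b))"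
    by (subst (1) lborel_eq, subst integral_distr)
      (auto simp: inner product_integral_prod assms cong: prod.cong)
qed

text \<open>The Fourier transform of the weight \<open>exp (- (c^2 * norm \<xi>^2) / 2)\<close>, in
  product form so that the one-dimensional computation applies coordinatewise.\<close>

definition gauss_kernel :: "real \<Rightarrow> 'a::euclidean_space \<Rightarrow> real" where
  "gauss_kernel c z = (\<Prod>b\<in>Basis. normal_density 0 (c / (2 * pi)) (z \<bullet> b))"

lemma measurable_gauss_kernel [measurable]:
  assumes [measurable]: "f \<in> borel_measurable M"
  shows "(\<lambda>x. gauss_kernel c (f x)) \<in> borel_measurable M"
  unfolding gauss_kernel_def by measurable

lemma gauss_kernel_nonneg: "0 \<le> gauss_kernel c z"
  by (simp add: gauss_kernel_def prod_nonneg)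

lemma gauss_kernel_minus: "gauss_kernel c (- z) = gauss_kernel c z"
  by (simp add: gauss_kernel_def normal_density_def)

lemma fourier_gaussian:
  fixes z :: "'a::euclidean_space"
  assumes c: "0 < c"
  shows "integrable lborel (\<lambda>\<xi>::'a. complex_of_real (exp (- (c\<^sup>2 * (norm \<xi>)\<^sup>2) / 2)))"
    and "(LINT \<xi>|lborel. cis2pi (\<xi> \<bullet> z) * complex_of_real (exp (- (c\<^sup>2 * (norm \<xi>)\<^sup>2) / 2)))
      = complex_of_real (gauss_kernel c z)"
proof -
  have w: "complex_of_real (exp (- (c\<^sup>2 * (norm \<xi>)\<^sup>2) / 2))
      = (\<Prod>b\<in>Basis. complex_of_real (exp (- (c\<^sup>2 * (\<xi> \<bullet> b)\<^sup>2) / 2)))" for \<xi> :: 'a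
  proof -
    have "(norm \<xi>)\<^sup>2 = (\<Sum>b\<in>Basis. (\<xi> \<bullet> b)\<^sup>2)"
      unfolding power2_norm_eq_inner by (subst euclidean_inner) (simp add: power2_eq_square)
    then have "- (c\<^sup>2 * (norm \<xi>)\<^sup>2) / 2 = (\<Sum>b\<in>Basis. - (c\<^sup>2 * (\<xi> \<bullet> b)\<^sup>2) / 2)"
      by (simp add: sum_distrib_left sum_negf sum_divide_distrib)
    then show ?thesis by (simp add: exp_sum)
  qed
  show "integrable lborel (\<lambda>\<xi>::'a. complex_of_real (exp (- (c\<^sup>2 * (norm \<xi>)\<^sup>2) / 2)))"
    unfolding w by (rule lborel_integral_prod) (rule gaussian_integral_real[OF c])
  have cis: "cis2pi (\<xi> \<bullet> z) = (\<Prod>b\<in>Basis. cis2pi ((\<xi> \<bullet> b) * (z \<bullet> b)))" for \<xi> :: 'a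
    by (subst euclidean_inner) (simp add: cis2pi_def sum_distrib_left exp_sum)
  have "(LINT \<xi>|lborel. cis2pi (\<xi> \<bullet> z) * complex_of_real (exp (- (c\<^sup>2 * (norm \<xi>)\<^sup>2) / 2)))
      = (LINT \<xi>|lborel. (\<Prod>b\<in>Basis. cis2pi ((\<xi> \<bullet> b) * (z \<bullet> b)) * complex_of_real (exp (- (c\<^sup>2 * (\<xi> \<bullet> b)\<^sup>2) / 2))))"
    unfolding w cis prod.distrib ..
  also have "\<dots> = (\<Prod>b\<in>Basis. LINT t|lborel. cis2pi (t * (z \<bullet> b)) * complex_of_real (exp (- (c\<^sup>2 * t\<^sup>2) / 2)))"
  proof (rule lborel_integral_prod(2))
    fix b :: 'a
    show "integrable lborel (\<lambda>t. cis2pi (t * (z \<bullet> b)) * complex_of_real (exp (- (c\<^sup>2 * t\<^sup>2) / 2)))"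
      by (rule Bochner_Integration.integrable_bound[OF gaussian_integral_real(1)[OF c]])
        (auto simp: norm_mult)
  qed
  also have "\<dots> = complex_of_real (gauss_kernel c z)"
    by (simp only: gaussian_integral_real(2)[OF c] gauss_kernel_def of_real_prod)
  finally show "(LINT \<xi>|lborel. cis2pi (\<xi> \<bullet> z) * complex_of_real (exp (- (c\<^sup>2 * (norm \<xi>)\<^sup>2) / 2)))
      = complex_of_real (gauss_kernel c z)" .
qed

lemma nn_integral_gauss_kernel:
  fixes y :: "'a::euclidean_space"
  assumes c: "0 < c"
  shows "(\<integral>\<^sup>+z. ennreal (gauss_kernel c (z - y)) \<partial>lborel) = 1"
proof -
  have 1: "(\<integral>\<^sup>+t. ennreal (normal_density 0 (c / (2 * pi)) t) \<partial>lborel) = 1"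
    using prob_space.emeasure_space_1[OF prob_space_normal_density[of "c / (2 * pi)" 0]] c
    by (simp add: emeasure_density)
  have "(\<integral>\<^sup>+z. ennreal (gauss_kernel c (z - y)) \<partial>lborel)
      = (\<integral>\<^sup>+z. ennreal (gauss_kernel c (z - y)) \<partial>distr lborel borel ((+) y))"
    by (simp add: lborel_distr_plus)
  also have "\<dots> = (\<integral>\<^sup>+z. ennreal (gauss_kernel c z) \<partial>(lborel :: 'a measure))"
    by (subst nn_integral_distr) auto
  also have "\<dots> = 1"
    unfolding gauss_kernel_def
    using nn_integral_lborel_prod[of "\<lambda>_::'a. \<lambda>t. ennreal (normal_density 0 (c / (2 * pi)) t)"]
    by (simp add: prod_ennreal[symmetric] 1)
  finally show ?thesis .
qed

section \<open>Plancherel's inequality\<close>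

lemma measurable_fourier [measurable]:
  assumes [measurable]: "f \<in> borel_measurable borel"
  shows "fourier f \<in> borel_measurable borel"
  unfolding fourier_eq[abs_def]
  by (rule lborel.borel_measurable_lebesgue_integral) measurable

lemma norm_fourier_le: "norm (fourier f \<xi>) \<le> (LINT x|lborel. norm (f x))"
  unfolding fourier_eq using integral_norm_bound[of lborel "\<lambda>x. cis2pi (\<xi> \<bullet> x) * f x"]
  by (simp add: norm_mult)

lemma integrable_cis2pi_mult:
  fixes f :: "'a::euclidean_space \<Rightarrow> complex"
  assumes "integrable lborel f"
  shows "integrable lborel (\<lambda>x. cis2pi (\<xi> \<bullet> x) * f x)"
proof -
  have [measurable]: "f \<in> borel_measurable borel" using assms by auto
  show ?thesis
    by (rule Bochner_Integration.integrable_bound[OF assms]) (auto simp: norm_mult)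
qed

text \<open>If \<open>f\<close> is not integrable, its Bochner integral is 0 by convention and the
  bound is trivial. This permits passing to nonnegative integrals before finiteness is
  known.\<close>

lemma ennreal_integral_le_nn_integral:
  fixes f :: "'a \<Rightarrow> real"
  assumes "\<And>x. 0 \<le> f x"
  shows "ennreal (integral\<^sup>L M f) \<le> (\<integral>\<^sup>+x. ennreal (f x) \<partial>M)"
  using assms by (cases "integrable M f") (simp_all add: nn_integral_eq_integral not_integrable_integral_eq)

text \<open>A Schur test: \<open>G y * G z\<close> is at most the mean of the two squares, and the
  kernel has mass one in each variable separately.\<close>

lemma gauss_kernel_bilinear_le:
  fixes G :: "'a::euclidean_space \<Rightarrow> real"
  assumes c: "0 < c" and [measurable]: "G \<in> borel_measurable borel" and G: "\<And>x. 0 \<le> G x"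
  shows "(\<integral>\<^sup>+z. \<integral>\<^sup>+y. ennreal (gauss_kernel c (y - z) * G y * G z) \<partial>lborel \<partial>lborel)
    \<le> (\<integral>\<^sup>+x. ennreal ((G x)\<^sup>2) \<partial>lborel)"
proof -
  let ?K = "\<lambda>y z. ennreal (gauss_kernel c (y - z))" and ?h = "\<lambda>x. ennreal ((G x)\<^sup>2 / 2)"
  have "(\<integral>\<^sup>+z. \<integral>\<^sup>+y. ennreal (gauss_kernel c (y - z) * G y * G z) \<partial>lborel \<partial>lborel)
      \<le> (\<integral>\<^sup>+z. \<integral>\<^sup>+y. ?K y z * ?h y + ?K y z * ?h z \<partial>lborel \<partial>lborel)"
  proof (intro nn_integral_mono)
    fix y z
    have "G y * G z \<le> (G y)\<^sup>2 / 2 + (G z)\<^sup>2 / 2"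
      using sum_squares_bound[of "G y" "G z"] by simp
    then have "gauss_kernel c (y - z) * (G y * G z) \<le> gauss_kernel c (y - z) * ((G y)\<^sup>2 / 2 + (G z)\<^sup>2 / 2)"
      by (intro mult_left_mono gauss_kernel_nonneg)
    then have "ennreal (gauss_kernel c (y - z) * G y * G z)
        \<le> ennreal (gauss_kernel c (y - z) * ((G y)\<^sup>2 / 2) + gauss_kernel c (y - z) * ((G z)\<^sup>2 / 2))"
      by (intro ennreal_leI) (simp add: algebra_simps)
    also have "\<dots> = ?K y z * ?h y + ?K y z * ?h z"
      by (simp only: ennreal_plus ennreal_mult gauss_kernel_nonneg mult_nonneg_nonneg
          zero_le_power2 divide_nonneg_nonneg zero_le_numeral)
    finally show "ennreal (gauss_kernel c (y - z) * G y * G z) \<le> ?K y z * ?h y + ?K y z * ?h z" .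
  qed
  also have "\<dots> = (\<integral>\<^sup>+z. \<integral>\<^sup>+y. ?K y z * ?h y \<partial>lborel \<partial>lborel) + (\<integral>\<^sup>+z. \<integral>\<^sup>+y. ?K y z * ?h z \<partial>lborel \<partial>lborel)"
    by (simp add: nn_integral_add)
  also have "(\<integral>\<^sup>+z. \<integral>\<^sup>+y. ?K y z * ?h y \<partial>lborel \<partial>lborel) = (\<integral>\<^sup>+y. \<integral>\<^sup>+z. ?K y z * ?h y \<partial>lborel \<partial>lborel)"
    by (rule lborel_pair.Fubini') simp
  also have "\<dots> = (\<integral>\<^sup>+y. ?h y \<partial>lborel)"
  proof (rule nn_integral_cong)
    fix y :: 'a
    have "?K y z = ennreal (gauss_kernel c (z - y))" for z
      using gauss_kernel_minus[of c "z - y"] by simp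
    then show "(\<integral>\<^sup>+z. ?K y z * ?h y \<partial>lborel) = ?h y"
      by (simp add: nn_integral_multc nn_integral_gauss_kernel[OF c])
  qed
  also have "(\<integral>\<^sup>+z. \<integral>\<^sup>+y. ?K y z * ?h z \<partial>lborel \<partial>lborel) = (\<integral>\<^sup>+z. ?h z \<partial>lborel)"
    by (simp add: nn_integral_multc nn_integral_gauss_kernel[OF c])
  also have "(\<integral>\<^sup>+y. ?h y \<partial>lborel) + (\<integral>\<^sup>+z. ?h z \<partial>lborel) = (\<integral>\<^sup>+x. ennreal ((G x)\<^sup>2) \<partial>lborel)"
    by (subst nn_integral_add[symmetric]) (auto simp: ennreal_plus[symmetric] simp del: ennreal_plus)
  finally show ?thesis .
qed

text \<open>Write the squared modulus as \<open>?F \<xi> * cnj (?F \<xi>)\<close> and exchange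
  integrals twice. The \<open>\<xi>\<close>-integral becomes \<open>gauss_kernel c (y - z)\<close>,
  leaving the bilinear form already bounded.\<close>

lemma plancherel_gaussian_le:
  fixes G :: "'a::euclidean_space \<Rightarrow> real"
  assumes c: "0 < c" and G: "integrable lborel G" "\<And>x. 0 \<le> G x"
  shows "(\<integral>\<^sup>+\<xi>. ennreal (exp (- (c\<^sup>2 * (norm \<xi>)\<^sup>2) / 2) * (norm (fourier (\<lambda>x. complex_of_real (G x)) \<xi>))\<^sup>2) \<partial>lborel)
    \<le> (\<integral>\<^sup>+x. ennreal ((G x)\<^sup>2) \<partial>lborel)"
proof -
  let ?Gc = "\<lambda>x. complex_of_real (G x)"
  let ?F = "fourier ?Gc"
  let ?w = "\<lambda>\<xi>::'a. complex_of_real (exp (- (c\<^sup>2 * (norm \<xi>)\<^sup>2) / 2))"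
  have [measurable]: "G \<in> borel_measurable borel" using G by auto
  have Gc: "integrable lborel ?Gc" using G by simp
  define B where "B = (LINT x|lborel. norm (?Gc x))"
  \<comment> \<open>The transform is only known to be bounded; the Gaussian weight is what makes the
    integrals in \<open>\<xi>\<close> converge.\<close>
  have FB: "norm (?F \<xi>) \<le> B" for \<xi> unfolding B_def by (rule norm_fourier_le)
  have B: "0 \<le> B" using FB[of 0] norm_ge_zero order_trans by blast
  have wF: "integrable lborel (\<lambda>\<xi>. ?w \<xi> * ?F \<xi>)"
  proof (rule Bochner_Integration.integrable_bound)
    show "integrable lborel (\<lambda>\<xi>. ?w \<xi> * complex_of_real B)"
      by (intro Bochner_Integration.integrable_mult_left fourier_gaussian(1) c)
  qed (auto simp: norm_mult B FB intro!: mult_left_mono)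
  have wz: "integrable lborel (\<lambda>\<xi>. ?w \<xi> * cis2pi (- (\<xi> \<bullet> z)))" for z
    by (rule Bochner_Integration.integrable_bound[OF fourier_gaussian(1)[OF c]]) (auto simp: norm_mult)
  have cnjF: "cnj (?F \<xi>) = (LINT z|lborel. cis2pi (- (\<xi> \<bullet> z)) * ?Gc z)" for \<xi>
    unfolding fourier_eq Bochner_Integration.integral_cnj[symmetric]
    by (simp add: cis2pi_eq_cis cis_cnj)
  have inner: "(LINT \<xi>|lborel. (?w \<xi> * ?F \<xi>) * cis2pi (- (\<xi> \<bullet> z)))
      = complex_of_real (LINT y|lborel. gauss_kernel c (y - z) * G y)" for z
  proof -
    have "(LINT \<xi>|lborel. (?w \<xi> * ?F \<xi>) * cis2pi (- (\<xi> \<bullet> z)))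
        = (LINT \<xi>|lborel. (?w \<xi> * cis2pi (- (\<xi> \<bullet> z))) * (LINT y|lborel. cis2pi (\<xi> \<bullet> y) * ?Gc y))"
      by (simp add: fourier_eq mult_ac)
    also have "\<dots> = (LINT y|lborel. (LINT \<xi>|lborel. (?w \<xi> * cis2pi (- (\<xi> \<bullet> z))) * cis2pi (\<xi> \<bullet> y)) * ?Gc y)"
      by (rule integral_bounded_kernel_swap[OF sigma_finite_lborel sigma_finite_lborel wz Gc]) simp_all
    also have "\<dots> = (LINT y|lborel. complex_of_real (gauss_kernel c (y - z)) * ?Gc y)"
    proof -
      have "(LINT \<xi>|lborel. (?w \<xi> * cis2pi (- (\<xi> \<bullet> z))) * cis2pi (\<xi> \<bullet> y))
          = (LINT \<xi>|lborel. cis2pi (\<xi> \<bullet> (y - z)) * ?w \<xi>)" for y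
        by (intro Bochner_Integration.integral_cong refl)
          (simp add: inner_diff_right cis2pi_eq_cis cis_mult algebra_simps)
      then show ?thesis by (simp only: fourier_gaussian(2)[OF c])
    qed
    also have "\<dots> = complex_of_real (LINT y|lborel. gauss_kernel c (y - z) * G y)"
      by (simp flip: integral_complex_of_real)
    finally show ?thesis .
  qed
  have "complex_of_real (LINT \<xi>|lborel. exp (- (c\<^sup>2 * (norm \<xi>)\<^sup>2) / 2) * (norm (?F \<xi>))\<^sup>2)
      = (LINT \<xi>|lborel. (?w \<xi> * ?F \<xi>) * cnj (?F \<xi>))"
    unfolding integral_complex_of_real[symmetric] of_real_mult complex_norm_square mult.assoc ..
  also have "\<dots> = (LINT z|lborel. (LINT \<xi>|lborel. (?w \<xi> * ?F \<xi>) * cis2pi (- (\<xi> \<bullet> z))) * ?Gc z)"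
    unfolding cnjF
    by (rule integral_bounded_kernel_swap[OF sigma_finite_lborel sigma_finite_lborel wF Gc]) simp_all
  also have "\<dots> = complex_of_real (LINT z|lborel. (LINT y|lborel. gauss_kernel c (y - z) * G y) * G z)"
    unfolding inner by (simp flip: integral_complex_of_real)
  finally have eq: "(LINT \<xi>|lborel. exp (- (c\<^sup>2 * (norm \<xi>)\<^sup>2) / 2) * (norm (?F \<xi>))\<^sup>2)
      = (LINT z|lborel. (LINT y|lborel. gauss_kernel c (y - z) * G y) * G z)"
    by (simp only: of_real_eq_iff)
  have "integrable lborel (\<lambda>\<xi>. exp (- (c\<^sup>2 * (norm \<xi>)\<^sup>2) / 2) * (norm (?F \<xi>))\<^sup>2)"
  proof (rule Bochner_Integration.integrable_bound)
    show "integrable lborel (\<lambda>\<xi>. ?w \<xi> * complex_of_real (B\<^sup>2))"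
      by (intro Bochner_Integration.integrable_mult_left fourier_gaussian(1) c)
  qed (auto simp: norm_mult norm_power B FB intro!: mult_left_mono power_mono)
  then have "(\<integral>\<^sup>+\<xi>. ennreal (exp (- (c\<^sup>2 * (norm \<xi>)\<^sup>2) / 2) * (norm (?F \<xi>))\<^sup>2) \<partial>lborel)
      = ennreal (LINT z|lborel. (LINT y|lborel. gauss_kernel c (y - z) * G y) * G z)"
    unfolding eq[symmetric] by (intro nn_integral_eq_integral) auto
  also have "\<dots> \<le> (\<integral>\<^sup>+z. ennreal ((LINT y|lborel. gauss_kernel c (y - z) * G y) * G z) \<partial>lborel)"
    by (intro ennreal_integral_le_nn_integral mult_nonneg_nonneg integral_nonneg_AE AE_I2
        gauss_kernel_nonneg G)
  also have "\<dots> \<le> (\<integral>\<^sup>+z. \<integral>\<^sup>+y. ennreal (gauss_kernel c (y - z) * G y * G z) \<partial>lborel \<partial>lborel)"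
  proof (rule nn_integral_mono)
    fix z
    have "ennreal ((LINT y|lborel. gauss_kernel c (y - z) * G y) * G z)
        = ennreal (LINT y|lborel. gauss_kernel c (y - z) * G y * G z)"
      by simp
    also have "\<dots> \<le> (\<integral>\<^sup>+y. ennreal (gauss_kernel c (y - z) * G y * G z) \<partial>lborel)"
      by (intro ennreal_integral_le_nn_integral mult_nonneg_nonneg gauss_kernel_nonneg G)
    finally show "ennreal ((LINT y|lborel. gauss_kernel c (y - z) * G y) * G z)
        \<le> (\<integral>\<^sup>+y. ennreal (gauss_kernel c (y - z) * G y * G z) \<partial>lborel)" .
  qed
  also have "\<dots> \<le> (\<integral>\<^sup>+x. ennreal ((G x)\<^sup>2) \<partial>lborel)"
    by (rule gauss_kernel_bilinear_le) (use c G in auto)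
  finally show ?thesis .
qed

text \<open>The weights with \<open>c = 1 / (N + 1)\<close> tend pointwise to 1, and Fatou preserves
  the uniform bound. The right side may be infinite.\<close>

lemma plancherel_le:
  fixes G :: "'a::euclidean_space \<Rightarrow> real"
  assumes G: "integrable lborel G" "\<And>x. 0 \<le> G x"
  shows "(\<integral>\<^sup>+\<xi>. ennreal ((norm (fourier (\<lambda>x. complex_of_real (G x)) \<xi>))\<^sup>2) \<partial>lborel)
    \<le> (\<integral>\<^sup>+x. ennreal ((G x)\<^sup>2) \<partial>lborel)"
proof -
  have [measurable]: "G \<in> borel_measurable borel" using G by auto
  let ?F = "fourier (\<lambda>x. complex_of_real (G x))"
  let ?c = "\<lambda>N. inverse (real (Suc N))"
  show ?thesis
  proof (rule nn_integral_le_of_tendsto)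
    fix \<xi> :: 'a
    have "(\<lambda>N. exp (- ((?c N)\<^sup>2 * (norm \<xi>)\<^sup>2) / 2) * (norm (?F \<xi>))\<^sup>2)
        \<longlonglongrightarrow> exp (- (0\<^sup>2 * (norm \<xi>)\<^sup>2) / 2) * (norm (?F \<xi>))\<^sup>2"
      by (intro tendsto_intros LIMSEQ_inverse_real_of_nat) auto
    then show "(\<lambda>N. ennreal (exp (- ((?c N)\<^sup>2 * (norm \<xi>)\<^sup>2) / 2) * (norm (?F \<xi>))\<^sup>2))
        \<longlonglongrightarrow> ennreal ((norm (?F \<xi>))\<^sup>2)"
      by (intro tendsto_ennrealI) simp
  next
    fix N
    show "(\<integral>\<^sup>+\<xi>. ennreal (exp (- ((?c N)\<^sup>2 * (norm \<xi>)\<^sup>2) / 2) * (norm (?F \<xi>))\<^sup>2) \<partial>lborel)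
        \<le> (\<integral>\<^sup>+x. ennreal ((G x)\<^sup>2) \<partial>lborel)"
      by (rule plancherel_gaussian_le) (use G in auto)
  qed simp
qed

section \<open>The Hausdorff-Young inequality\<close>

text \<open>Marcinkiewicz interpolation between the trivial bound and Plancherel.  The function is cut at
  the level where \<open>lev * G powr (s - 1) = 2 * \<alpha>\<close>, so that the large part has transform at most
  \<open>lev / 2\<close>; the parameter \<open>\<tau> = lev powr (m - 2)\<close> makes the layer-cake integral one against
  Lebesgue measure.\<close>

lemma hausdorff_young_strict:
  fixes G :: "'a::euclidean_space \<Rightarrow> real"
  assumes m: "2 < m" and G: "integrable lborel G" "\<And>x. 0 \<le> G x"
    and \<alpha>: "(\<integral>\<^sup>+x. ennreal (G x powr (m / (m - 1))) \<partial>lborel) = ennreal \<alpha>" "0 < \<alpha>"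
  shows "(\<integral>\<^sup>+\<xi>. ennreal (norm (fourier (\<lambda>x. complex_of_real (G x)) \<xi>) powr m) \<partial>lborel)
    \<le> ennreal (2 powr m * \<alpha> powr (m - 1))"
proof -
  have [measurable]: "G \<in> borel_measurable borel" using G by auto
  define s where "s = m / (m - 1)"
  have s: "0 < s - 1" "(s - 1) * (m - 2) = 2 - s" "1 < s" using m by (auto simp: s_def field_simps)
  let ?F = "fourier (\<lambda>x. complex_of_real (G x))"
  define lev where "lev \<tau> = \<tau> powr (1 / (m - 2))" for \<tau>
  have [measurable]: "lev \<in> borel_measurable borel" unfolding lev_def[abs_def] by measurable
  define L where "L \<tau> y = (if lev \<tau> * G y powr (s - 1) \<le> 2 * \<alpha> then G y else 0)" for \<tau> y
  define H where "H \<tau> y = (if lev \<tau> * G y powr (s - 1) \<le> 2 * \<alpha> then 0 else G y)" for \<tau> y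
  have [measurable]: "(\<lambda>p. L (fst p) (snd p)) \<in> borel_measurable (borel \<Otimes>\<^sub>M borel)"
    "\<And>\<tau>. L \<tau> \<in> borel_measurable borel" "\<And>\<tau>. H \<tau> \<in> borel_measurable borel"
    unfolding L_def[abs_def] H_def[abs_def] by measurable
  have L0: "0 \<le> L \<tau> y" and H0: "0 \<le> H \<tau> y" for \<tau> y using G(2) by (auto simp: L_def H_def)
  have Li: "integrable lborel (L \<tau>)" and Hi: "integrable lborel (H \<tau>)" for \<tau>
    by (rule Bochner_Integration.integrable_bound[OF G(1)], auto simp: L_def H_def)+
  define FL where "FL \<tau> \<xi> = norm (fourier (\<lambda>x. complex_of_real (L \<tau> x)) \<xi>)" for \<tau> \<xi>
  have FL_meas [measurable]: "(\<lambda>p. FL (fst p) (snd p)) \<in> borel_measurable (borel \<Otimes>\<^sub>M borel)"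
  proof -
    have "(\<lambda>p. LINT y|lborel. cis2pi (snd p \<bullet> y) * complex_of_real (L (fst p) y))
        \<in> borel_measurable ((borel :: real measure) \<Otimes>\<^sub>M (borel :: 'a measure))"
      by (rule lborel.borel_measurable_lebesgue_integral)
        (simp add: split_beta' L_def)
    then show ?thesis unfolding FL_def fourier_eq by measurable
  qed
  have Gs: "integrable lborel (\<lambda>y. G y powr s)" "(LINT y|lborel. G y powr s) = \<alpha>"
  proof -
    show int: "integrable lborel (\<lambda>y. G y powr s)"
      using \<alpha> by (intro integrableI_nonneg) (auto simp: s_def)
    have "ennreal (LINT y|lborel. G y powr s) = ennreal \<alpha>"
      using nn_integral_eq_integral[OF int] \<alpha> by (simp add: s_def)
    then show "(LINT y|lborel. G y powr s) = \<alpha>"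
      using \<alpha>(2) by (simp add: integral_nonneg_AE)
  qed
  have high: "norm (fourier (\<lambda>x. complex_of_real (H \<tau> x)) \<xi>) \<le> lev \<tau> / 2" if "0 < \<tau>" for \<tau> \<xi>
  proof -
    have "norm (fourier (\<lambda>x. complex_of_real (H \<tau> x)) \<xi>) \<le> (LINT y|lborel. H \<tau> y)"
      using norm_fourier_le[of "\<lambda>x. complex_of_real (H \<tau> x)" \<xi>] H0 by simp
    \<comment> \<open>Where \<open>H\<close> does not vanish, the cut gives
      \<open>1 < lev \<tau> * G y powr (s - 1) / (2 * \<alpha>)\<close>; inserting this factor
      trades \<open>G\<close> for \<open>G powr s\<close>, whose integral is
      \<open>\<alpha>\<close>.\<close>
    also have "\<dots> \<le> (LINT y|lborel. lev \<tau> / (2 * \<alpha>) * G y powr s)"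
    proof (rule integral_mono)
      fix y
      show "H \<tau> y \<le> lev \<tau> / (2 * \<alpha>) * G y powr s"
      proof (cases "lev \<tau> * G y powr (s - 1) \<le> 2 * \<alpha>")
        case True
        then show ?thesis using \<alpha>(2) by (simp add: H_def lev_def)
      next
        case False
        then have "2 * \<alpha> * G y \<le> lev \<tau> * G y powr (s - 1) * G y"
          using G(2)[of y] by (intro mult_right_mono) auto
        moreover have "G y powr (s - 1) * G y = G y powr s"
          using powr_add[of "G y" "s - 1" 1] G(2)[of y] by simp
        ultimately have "2 * \<alpha> * G y \<le> lev \<tau> * G y powr s" by (simp add: mult.assoc)
        then show ?thesis using False \<alpha>(2) by (simp add: H_def field_simps)
      qed
    qed (use Hi Gs in auto)
    also have "\<dots> = lev \<tau> / 2" using Gs \<alpha>(2) by simp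
    finally show ?thesis .
  qed
  have split: "norm (?F \<xi>) \<le> FL \<tau> \<xi> + lev \<tau> / 2" if "0 < \<tau>" for \<tau> \<xi>
  proof -
    have "?F \<xi> = (LINT x|lborel. cis2pi (\<xi> \<bullet> x) * complex_of_real (L \<tau> x) + cis2pi (\<xi> \<bullet> x) * complex_of_real (H \<tau> x))"
      unfolding fourier_eq by (intro Bochner_Integration.integral_cong refl) (simp add: L_def H_def)
    also have "\<dots> = fourier (\<lambda>x. complex_of_real (L \<tau> x)) \<xi> + fourier (\<lambda>x. complex_of_real (H \<tau> x)) \<xi>"
      unfolding fourier_eq by (intro Bochner_Integration.integral_add integrable_cis2pi_mult) (use Li Hi in auto)
    finally have "norm (?F \<xi>) \<le> FL \<tau> \<xi> + norm (fourier (\<lambda>x. complex_of_real (H \<tau> x)) \<xi>)"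
      unfolding FL_def using norm_triangle_ineq by metis
    then show ?thesis using high[OF that, of \<xi>] by simp
  qed
  have pw: "ennreal (norm (?F \<xi>) powr m) \<le> (\<integral>\<^sup>+\<tau>. 4 * (indicator {0<..} \<tau> * ennreal ((FL \<tau> \<xi>)\<^sup>2)) \<partial>lborel)" for \<xi>
  proof -
    define X where "X = norm (?F \<xi>)"
    have X: "0 \<le> X" by (simp add: X_def)
    have "ennreal (X powr m) = ennreal (X\<^sup>2) * ennreal (X powr (m - 2))"
    proof -
      have "X powr m = X powr 2 * X powr (m - 2)" by (simp flip: powr_add)
      then show ?thesis using X by (simp add: ennreal_mult)
    qed
    \<comment> \<open>Layer cake: \<open>X powr (m - 2)\<close> is the length of an interval of
      \<open>\<tau>\<close>. On it \<open>lev \<tau> \<le> X\<close>, so the term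
      \<open>lev \<tau> / 2\<close> in \<open>split\<close> is absorbed and
      \<open>X \<le> 2 * FL \<tau> \<xi>\<close>; squaring produces the factor 4.\<close>
    also have "\<dots> = (\<integral>\<^sup>+\<tau>. ennreal (X\<^sup>2) * indicator {0<..X powr (m - 2)} \<tau> \<partial>lborel)"
      by (subst nn_integral_cmult_indicator) auto
    also have "\<dots> \<le> (\<integral>\<^sup>+\<tau>. 4 * (indicator {0<..} \<tau> * ennreal ((FL \<tau> \<xi>)\<^sup>2)) \<partial>lborel)"
    proof (rule nn_integral_mono)
      fix \<tau> :: real
      show "ennreal (X\<^sup>2) * indicator {0<..X powr (m - 2)} \<tau> \<le> 4 * (indicator {0<..} \<tau> * ennreal ((FL \<tau> \<xi>)\<^sup>2))"
      proof (cases "0 < \<tau> \<and> \<tau> \<le> X powr (m - 2)")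
        case True
        then have "lev \<tau> \<le> (X powr (m - 2)) powr (1 / (m - 2))"
          unfolding lev_def using m by (intro powr_mono2) auto
        also have "\<dots> = X" using m X by (simp add: powr_powr)
        finally have "X \<le> 2 * FL \<tau> \<xi>" using split[of \<tau> \<xi>] True by (simp add: X_def)
        then have "X\<^sup>2 \<le> (2 * FL \<tau> \<xi>)\<^sup>2" using X by (intro power_mono) auto
        then have "ennreal (X\<^sup>2) \<le> ennreal (4 * (FL \<tau> \<xi>)\<^sup>2)"
          by (intro ennreal_leI) (simp add: power_mult_distrib)
        then show ?thesis using True by (simp add: ennreal_mult)
      qed (auto simp: indicator_def)
    qed
    finally show ?thesis by (simp add: X_def)
  qed
  have "(\<integral>\<^sup>+\<xi>. ennreal (norm (?F \<xi>) powr m) \<partial>lborel)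
      \<le> (\<integral>\<^sup>+\<xi>. \<integral>\<^sup>+\<tau>. 4 * (indicator {0<..} \<tau> * ennreal ((FL \<tau> \<xi>)\<^sup>2)) \<partial>lborel \<partial>lborel)"
    by (intro nn_integral_mono pw)
  \<comment> \<open>With \<open>\<tau>\<close> outermost, Plancherel can be applied to the low part
    at each fixed level.\<close>
  also have "\<dots> = (\<integral>\<^sup>+\<tau>. \<integral>\<^sup>+\<xi>. 4 * (indicator {0<..} \<tau> * ennreal ((FL \<tau> \<xi>)\<^sup>2)) \<partial>lborel \<partial>lborel)"
    using FL_meas by (intro lborel_pair.Fubini') (simp add: split_beta')
  also have "\<dots> \<le> (\<integral>\<^sup>+\<tau>. 4 * (indicator {0<..} \<tau> * (\<integral>\<^sup>+y. ennreal ((L \<tau> y)\<^sup>2) \<partial>lborel)) \<partial>lborel)"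
  proof (rule nn_integral_mono)
    fix \<tau> :: real
    have [measurable]: "FL \<tau> \<in> borel_measurable borel"
      unfolding FL_def[abs_def] by measurable
    have "(\<integral>\<^sup>+\<xi>. 4 * (indicator {0<..} \<tau> * ennreal ((FL \<tau> \<xi>)\<^sup>2)) \<partial>lborel)
        = 4 * (indicator {0<..} \<tau> * (\<integral>\<^sup>+\<xi>. ennreal ((FL \<tau> \<xi>)\<^sup>2) \<partial>lborel))"
      by (simp add: nn_integral_cmult)
    also have "\<dots> \<le> 4 * (indicator {0<..} \<tau> * (\<integral>\<^sup>+y. ennreal ((L \<tau> y)\<^sup>2) \<partial>lborel))"
      unfolding FL_def by (intro mult_left_mono plancherel_le Li L0) auto
    finally show "(\<integral>\<^sup>+\<xi>. 4 * (indicator {0<..} \<tau> * ennreal ((FL \<tau> \<xi>)\<^sup>2)) \<partial>lborel)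
        \<le> 4 * (indicator {0<..} \<tau> * (\<integral>\<^sup>+y. ennreal ((L \<tau> y)\<^sup>2) \<partial>lborel))" .
  qed
  \<comment> \<open>Now the order is reversed again, so that for fixed \<open>y\<close> the integral
    in \<open>\<tau>\<close> can be computed.\<close>
  also have "\<dots> = (\<integral>\<^sup>+\<tau>. \<integral>\<^sup>+y. 4 * (indicator {0<..} \<tau> * ennreal ((L \<tau> y)\<^sup>2)) \<partial>lborel \<partial>lborel)"
    by (simp add: nn_integral_cmult)
  also have "\<dots> = (\<integral>\<^sup>+y. \<integral>\<^sup>+\<tau>. 4 * (indicator {0<..} \<tau> * ennreal ((L \<tau> y)\<^sup>2)) \<partial>lborel \<partial>lborel)"
    by (rule lborel_pair.Fubini') (simp add: split_beta' L_def)
  also have "\<dots> \<le> (\<integral>\<^sup>+y. ennreal (4 * (2 * \<alpha>) powr (m - 2)) * ennreal (G y powr s) \<partial>lborel)"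
  proof (rule nn_integral_mono)
    fix y
    show "(\<integral>\<^sup>+\<tau>. 4 * (indicator {0<..} \<tau> * ennreal ((L \<tau> y)\<^sup>2)) \<partial>lborel)
        \<le> ennreal (4 * (2 * \<alpha>) powr (m - 2)) * ennreal (G y powr s)"
    proof (cases "G y = 0")
      case True
      then show ?thesis by (simp add: L_def)
    next
      case False
      then have Gy: "0 < G y" using G(2)[of y] by simp
      \<comment> \<open>The cut condition solved for \<open>\<tau>\<close>:
        \<open>L \<tau> y\<close> vanishes for \<open>\<tau>\<close> above \<open>T\<close>, so the
        \<open>\<tau>\<close>-integral is a multiple of the length \<open>T\<close>.\<close>
      define T where "T = (2 * \<alpha> / G y powr (s - 1)) powr (m - 2)"
      have "4 * (indicator {0<..} \<tau> * ennreal ((L \<tau> y)\<^sup>2)) \<le> ennreal (4 * (G y)\<^sup>2) * indicator {0<..T} \<tau>" for \<tau>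
      proof (cases "0 < \<tau> \<and> lev \<tau> * G y powr (s - 1) \<le> 2 * \<alpha>")
        case True
        then have "lev \<tau> \<le> 2 * \<alpha> / G y powr (s - 1)" using Gy by (simp add: field_simps)
        then have "lev \<tau> powr (m - 2) \<le> T" unfolding T_def lev_def using m by (intro powr_mono2) auto
        moreover have "lev \<tau> powr (m - 2) = \<tau>" using m True by (simp add: lev_def powr_powr)
        ultimately show ?thesis using True by (simp add: L_def ennreal_mult)
      qed (auto simp: L_def indicator_def)
      then have "(\<integral>\<^sup>+\<tau>. 4 * (indicator {0<..} \<tau> * ennreal ((L \<tau> y)\<^sup>2)) \<partial>lborel)
          \<le> (\<integral>\<^sup>+\<tau>. ennreal (4 * (G y)\<^sup>2) * indicator {0<..T} \<tau> \<partial>lborel)"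
        by (intro nn_integral_mono)
      also have "\<dots> = ennreal (4 * (G y)\<^sup>2 * T)"
        by (subst nn_integral_cmult_indicator) (auto simp: ennreal_mult T_def)
      also have "4 * (G y)\<^sup>2 * T = 4 * (2 * \<alpha>) powr (m - 2) * G y powr s"
      proof -
        have "T = (2 * \<alpha>) powr (m - 2) / G y powr (2 - s)"
          using Gy \<alpha>(2) by (simp add: T_def powr_divide powr_powr s)
        moreover have "(G y)\<^sup>2 = G y powr s * G y powr (2 - s)"
          using Gy by (simp flip: powr_add)
        ultimately show ?thesis using Gy by simp
      qed
      finally show ?thesis by (simp add: ennreal_mult)
    qed
  qed
  also have "\<dots> = ennreal (4 * (2 * \<alpha>) powr (m - 2)) * ennreal \<alpha>"
    using \<alpha>(1) by (simp add: nn_integral_cmult s_def)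
  also have "\<dots> = ennreal (2 powr m * \<alpha> powr (m - 1))"
  proof -
    have "(2 * \<alpha>) powr (m - 2) = 2 powr (m - 2) * \<alpha> powr (m - 2)"
      using \<alpha>(2) by (simp add: powr_mult)
    moreover have "2 powr m = 4 * 2 powr (m - 2)" "\<alpha> powr (m - 1) = \<alpha> powr (m - 2) * \<alpha>"
      using powr_add[of 2 2 "m - 2"] powr_add[of \<alpha> "m - 2" 1] \<alpha>(2) by simp_all
    ultimately show ?thesis using \<alpha>(2) by (simp add: ennreal_mult[symmetric] mult_ac)
  qed
  finally show ?thesis .
qed

text \<open>Interpolation handles \<open>2 < m\<close> with a finite nonzero integral. At
  \<open>m = 2\<close> the level function, with its exponent \<open>1 / (m - 2)\<close>, degenerates
  and Plancherel is used directly; integral 0 means that \<open>G\<close> vanishes almost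
  everywhere.\<close>

lemma hausdorff_young:
  fixes G :: "'a::euclidean_space \<Rightarrow> real"
  assumes m: "2 \<le> m" and G: "integrable lborel G" "\<And>x. 0 \<le> G x"
  shows "(\<integral>\<^sup>+\<xi>. ennreal (norm (fourier (\<lambda>x. complex_of_real (G x)) \<xi>) powr m) \<partial>lborel)
    \<le> ennreal (2 powr m) * epow (m - 1) (\<integral>\<^sup>+x. ennreal (G x powr (m / (m - 1))) \<partial>lborel)"
    (is "?lhs \<le> _ * epow _ ?A")
proof -
  have [measurable]: "G \<in> borel_measurable borel" using G by auto
  consider "?A = top" | "?A = 0" | "m = 2" | "2 < m" "?A \<noteq> top" "?A \<noteq> 0"
    using m by fastforce
  then show ?thesis
  proof cases
    case 1
    then show ?thesis by (simp add: ennreal_mult_top)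
  next
    case 2
    then have "AE x in lborel. G x = 0"
      using G(2) by (auto simp: nn_integral_0_iff_AE)
    then have "AE x in lborel. cis2pi (\<xi> \<bullet> x) * complex_of_real (G x) = 0" for \<xi>
      by eventually_elim simp
    then have "fourier (\<lambda>x. complex_of_real (G x)) \<xi> = 0" for \<xi>
      unfolding fourier_eq by (rule integral_eq_zero_AE)
    then show ?thesis by simp
  next
    case 3
    then have "?lhs \<le> ?A"
      using plancherel_le[OF G] G(2) by simp
    also have "\<dots> \<le> ennreal (2 powr m) * ?A"
      using mult_right_mono[of 1 "ennreal (2 powr m)" ?A] 3 by simp
    finally show ?thesis using 3 by simp
  next
    case 4
    define \<alpha> where "\<alpha> = enn2real ?A"
    have \<alpha>: "?A = ennreal \<alpha>" "0 < \<alpha>"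
      using 4 by (auto simp: \<alpha>_def enn2real_positive_iff less_top zero_less_iff_neq_zero)
    show ?thesis
      using hausdorff_young_strict[OF 4(1) G \<alpha>] \<alpha> by (simp add: ennreal_mult)
  qed
qed

section \<open>The extension estimate\<close>

lemma epow_of_nat: "1 \<le> n \<Longrightarrow> epow (real n) a = a ^ n"
proof (induction n rule: dec_induct)
  case (step n)
  then show ?case
    using epow_add[of a "real n" 1] by (cases "a = top") (simp_all add: add.commute mult.commute)
qed simp

text \<open>The conjugate exponent \<open>q / (q - 1)\<close> turns the weight into
  \<open>u powr q\<close>. This verifies the hypothesis \<open>H\<close> of the iterated
  bound.\<close>

lemma hoelder_power_weight:
  fixes u :: "'a \<Rightarrow> real"
  assumes q: "1 \<le> q" and [measurable]: "u \<in> borel_measurable M" "\<phi> \<in> borel_measurable M"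
    and u: "\<And>x. 0 \<le> u x"
  shows "epow q (\<integral>\<^sup>+x. ennreal (u x powr (q - 1)) * \<phi> x \<partial>M)
    \<le> epow (q - 1) (\<integral>\<^sup>+x. ennreal (u x powr q) \<partial>M) * (\<integral>\<^sup>+x. epow q (\<phi> x) \<partial>M)"
proof (cases "q = 1")
  case False
  then have "1 < q" using q by simp
  then show ?thesis
    using hoelder_nn_integral[of q "\<lambda>x. ennreal (u x powr (q - 1))" M \<phi>]
    by (simp add: powr_powr)
next
  \<comment> \<open>For \<open>q = 1\<close>, \<open>u powr 0\<close> is the indicator of the set
    where \<open>u\<close> is nonzero, and \<open>epow 0\<close> of the integral of \<open>u\<close>
    is 0 if that integral vanishes and at least 1 otherwise.\<close>
  case True
  let ?U = "\<integral>\<^sup>+x. ennreal (u x) \<partial>M"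
  show ?thesis
  proof (cases "?U = 0")
    case True
    then have "AE x in M. u x = 0"
      using u by (auto simp: nn_integral_0_iff_AE)
    then have "(\<integral>\<^sup>+x. ennreal (u x powr 0) * \<phi> x \<partial>M) = 0"
      by (subst nn_integral_0_iff_AE) auto
    then show ?thesis using \<open>q = 1\<close> by simp
  next
    case False
    then have "1 \<le> epow 0 ?U" by (cases ?U) auto
    then have "1 * (\<integral>\<^sup>+x. \<phi> x \<partial>M) \<le> epow 0 ?U * (\<integral>\<^sup>+x. \<phi> x \<partial>M)"
      by (rule mult_right_mono) simp
    moreover have "(\<integral>\<^sup>+x. ennreal (u x powr 0) * \<phi> x \<partial>M) \<le> (\<integral>\<^sup>+x. 1 * \<phi> x \<partial>M)"
      by (intro nn_integral_mono mult_right_mono) auto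
    ultimately show ?thesis using True u by simp
  qed
qed

text \<open>The \<open>n\<close>-th power of the transform is the transform of the density
  \<open>G\<close> of the convolution power, so its \<open>real n * (Q * \<rho>)\<close>-th power
  integral is a Hausdorff-Young quantity for \<open>G\<close>. Membership of \<open>h\<close> in
  \<open>L^r\<close> enters as the pairing bound \<open>Hh\<close>, which treats finite and infinite
  \<open>r\<close> alike.\<close>

lemma extension_estimate:
  fixes \<mu> :: "'a::ordered_euclidean_space measure" and h u :: "'a \<Rightarrow> real"
  assumes \<mu>: "finite_measure \<mu>" "sets \<mu> = sets borel" and n: "1 \<le> n"
    and h: "h \<in> borel_measurable borel" "conv_power \<mu> n = density lborel (\<lambda>x. ennreal (h x))"
    and Hh: "\<And>\<psi>. \<psi> \<in> borel_measurable borel \<Longrightarrow>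
      epow \<rho> (\<integral>\<^sup>+x. ennreal (h x) * \<psi> x \<partial>lborel) \<le> B * (\<integral>\<^sup>+x. epow \<rho> (\<psi> x) \<partial>lborel)"
    and \<rho>: "1 \<le> \<rho>" and Q: "1 \<le> Q" and m: "2 \<le> Q * \<rho>"
    and u: "u \<in> borel_measurable borel" "\<And>x. 0 \<le> u x"
    and fin: "finite_measure (density \<mu> (\<lambda>x. ennreal (u x powr (Q - 1))))"
  shows "(\<integral>\<^sup>+x. ennreal (norm (fourier_measure (density \<mu> (\<lambda>x. ennreal (u x powr (Q - 1)))) x)
        powr (real n * (Q * \<rho>))) \<partial>lborel)
    \<le> ennreal (2 powr (Q * \<rho>)) * B * epow (\<rho> * real n * (Q - 1)) (\<integral>\<^sup>+x. ennreal (u x powr Q) \<partial>\<mu>)"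
proof -
  note [measurable] = h(1) u(1) and [measurable_cong] = \<mu>(2)
  let ?m = "Q * \<rho>"
  let ?g = "\<lambda>x. ennreal (u x powr (Q - 1))"
  let ?\<nu> = "density \<mu> ?g"
  define K where "K = epow (Q - 1) (\<integral>\<^sup>+x. ennreal (u x powr Q) \<partial>\<mu>)"
  \<comment> \<open>The factor \<open>K ^ n\<close> comes from Hoelder over the \<open>n\<close>
    convolution factors, \<open>B\<close> from pairing with \<open>h\<close>; the outer exponent
    \<open>\<rho>\<close> links the two.\<close>
  define D where "D = epow \<rho> (K ^ n) * B"
  have H: "epow Q (\<integral>\<^sup>+x. ?g x * \<phi> x \<partial>\<mu>) \<le> K * (\<integral>\<^sup>+x. epow Q (\<phi> x) \<partial>\<mu>)"
    if [measurable]: "\<phi> \<in> borel_measurable borel" for \<phi>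
    unfolding K_def by (rule hoelder_power_weight) (use Q u(2) in auto)
  have ac: "absolutely_continuous lborel (conv_power \<mu> n)"
    unfolding h(2) by (rule absolutely_continuousI_density) simp
  have Q0: "0 \<le> Q" using Q by simp
  have gm: "?g \<in> borel_measurable borel" by simp
  obtain G :: "'a \<Rightarrow> real" where G: "integrable lborel G" "\<And>x. 0 \<le> G x"
    and \<nu>n: "conv_power ?\<nu> n = density lborel (\<lambda>x. ennreal (G x))"
    using conv_power_has_density[OF \<mu> fin gm H Q0 n ac] by blast
  have [measurable]: "G \<in> borel_measurable borel" using G by auto
  have "epow ?m (\<integral>\<^sup>+x. \<phi> x * ennreal (G x) \<partial>lborel) \<le> D * (\<integral>\<^sup>+x. epow ?m (\<phi> x) \<partial>lborel)"
    if "\<phi> \<in> borel_measurable lborel" for \<phi>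
  proof -
    have [measurable]: "\<phi> \<in> borel_measurable borel" using that by simp
    have "(\<integral>\<^sup>+x. \<phi> x * ennreal (G x) \<partial>lborel) = (\<integral>\<^sup>+x. \<phi> x \<partial>conv_power ?\<nu> n)"
      unfolding \<nu>n by (subst nn_integral_density) (auto simp: mult.commute)
    then have "epow ?m (\<integral>\<^sup>+x. \<phi> x * ennreal (G x) \<partial>lborel)
        = epow \<rho> (epow Q (\<integral>\<^sup>+x. \<phi> x \<partial>conv_power ?\<nu> n))"
      by (simp add: epow_epow mult.commute)
    also have "\<dots> \<le> epow \<rho> (K ^ n * (\<integral>\<^sup>+x. epow Q (\<phi> x) \<partial>conv_power \<mu> n))"
      by (intro epow_mono conv_power_density_nn_integral_le[OF \<mu> fin gm H Q0 n]) (use \<rho> in auto)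
    also have "(\<integral>\<^sup>+x. epow Q (\<phi> x) \<partial>conv_power \<mu> n) = (\<integral>\<^sup>+x. ennreal (h x) * epow Q (\<phi> x) \<partial>lborel)"
      unfolding h(2) by (subst nn_integral_density) auto
    also have "epow \<rho> (K ^ n * \<dots>) \<le> epow \<rho> (K ^ n) * (B * (\<integral>\<^sup>+x. epow \<rho> (epow Q (\<phi> x)) \<partial>lborel))"
      unfolding epow_mult by (intro mult_left_mono Hh) auto
    finally show ?thesis
      by (simp add: D_def epow_epow mult.assoc mult.commute[of Q])
  qed
  then have GD: "epow (?m - 1) (\<integral>\<^sup>+x. ennreal (G x powr (?m / (?m - 1))) \<partial>lborel) \<le> D"
    by (intro Lp_bound_by_duality) (use G m in auto)
  have "norm (fourier_measure ?\<nu> x) powr (real n * ?m)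
      = norm (fourier (\<lambda>x. complex_of_real (G x)) x) powr ?m" for x
  proof -
    have "fourier (\<lambda>x. complex_of_real (G x)) x = fourier_measure ?\<nu> x ^ n"
      using fourier_measure_conv_power[OF fin _ n, of x] fourier_measure_density_lborel[OF _ G(2), where \<xi>=x] \<mu>(2)
      by (simp add: \<nu>n)
    \<comment> \<open>At \<open>t = 0\<close> this relies on \<open>1 \<le> n\<close>:
      \<open>0 ^ 0\<close> is 1 but \<open>0 powr 0\<close> is 0.\<close>
    moreover have "t ^ n = t powr real n" if "0 \<le> t" for t :: real
      using that n by (cases "t = 0") (auto simp: powr_realpow)
    ultimately show ?thesis by (simp add: norm_power powr_powr)
  qed
  then have "(\<integral>\<^sup>+x. ennreal (norm (fourier_measure ?\<nu> x) powr (real n * ?m)) \<partial>lborel)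
      \<le> ennreal (2 powr ?m) * epow (?m - 1) (\<integral>\<^sup>+x. ennreal (G x powr (?m / (?m - 1))) \<partial>lborel)"
    using hausdorff_young[OF m G] by simp
  also have "\<dots> \<le> ennreal (2 powr ?m) * D"
    by (intro mult_left_mono GD) auto
  also have "D = B * epow (\<rho> * real n * (Q - 1)) (\<integral>\<^sup>+x. ennreal (u x powr Q) \<partial>\<mu>)"
    using n by (simp add: D_def K_def epow_epow epow_of_nat[symmetric] mult_ac)
  finally show ?thesis by (simp add: mult.assoc)
qed

section \<open>The restriction estimate at the endpoint\<close>

text \<open>Duality with the weight \<open>u powr (Q - 1)\<close>. Taking the positive part of a
  rotated real part keeps this weight nonnegative, so it defines a measure to which the extension
  estimate applies. The power of \<open>U\<close> that appears on the right is then absorbed on the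
  left.\<close>

lemma restriction_estimate_real_part:
  fixes \<mu> :: "'a::ordered_euclidean_space measure" and h :: "'a \<Rightarrow> real" and f :: "'a \<Rightarrow> complex"
  assumes \<mu>: "prob_space \<mu>" "sets \<mu> = sets borel" and n: "1 \<le> n"
    and h: "h \<in> borel_measurable borel" "conv_power \<mu> n = density lborel (\<lambda>x. ennreal (h x))"
    and Hh: "\<And>\<psi>. \<psi> \<in> borel_measurable borel \<Longrightarrow>
      epow \<rho> (\<integral>\<^sup>+x. ennreal (h x) * \<psi> x \<partial>lborel) \<le> B * (\<integral>\<^sup>+x. epow \<rho> (\<psi> x) \<partial>lborel)"
    and \<rho>: "1 \<le> \<rho>" and Q: "1 \<le> Q" and m: "2 \<le> Q * \<rho>" and P: "P = real n * (Q * \<rho>)"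
    and f: "integrable lborel f" and c: "norm c = 1"
    and u_def: "\<And>\<xi>. u \<xi> = max 0 (Re (c * fourier f \<xi>))"
  shows "epow (real n * \<rho>) (\<integral>\<^sup>+\<xi>. ennreal (u \<xi> powr Q) \<partial>\<mu>)
    \<le> ennreal (2 powr (Q * \<rho>)) * B * epow (P - 1) (\<integral>\<^sup>+x. ennreal (norm (f x) powr (P / (P - 1))) \<partial>lborel)"
proof -
  interpret prob_space \<mu> by fact
  note [measurable_cong] = \<mu>(2)
  have [measurable]: "f \<in> borel_measurable borel" using f by auto
  have u_meas [measurable]: "u \<in> borel_measurable borel" unfolding u_def[abs_def] by measurable
  have u0: "0 \<le> u \<xi>" for \<xi> by (simp add: u_def)
  define M where "M = (LINT x|lborel. norm (f x))"
  \<comment> \<open>Boundedness of \<open>u\<close> makes all integrals against \<open>\<mu>\<close>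
    finite, in particular \<open>U\<close>, which is needed for the final absorption.\<close>
  have uM: "u \<xi> \<le> M" for \<xi>
  proof -
    have "Re (c * fourier f \<xi>) \<le> norm (fourier f \<xi>)"
      using complex_Re_le_cmod[of "c * fourier f \<xi>"] c by (simp add: norm_mult)
    then show ?thesis using norm_fourier_le[of f \<xi>] norm_ge_zero[of "fourier f \<xi>"]
      unfolding u_def M_def by linarith
  qed
  let ?g = "\<lambda>\<xi>. u \<xi> powr (Q - 1)"
  have gM: "?g \<xi> \<le> M powr (Q - 1)" and uQM: "u \<xi> powr Q \<le> M powr Q" for \<xi>
    using uM u0 Q by (auto intro: powr_mono2)
  let ?\<nu> = "density \<mu> (\<lambda>\<xi>. ennreal (?g \<xi>))"
  have g_int: "integrable \<mu> ?g" and uQ_int: "integrable \<mu> (\<lambda>\<xi>. u \<xi> powr Q)"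
    by (rule integrable_const_bound[where B="M powr (Q - 1)"], use gM in auto)
      (rule integrable_const_bound[where B="M powr Q"], use uQM in auto)
  have fin: "finite_measure ?\<nu>"
  proof
    show "emeasure ?\<nu> (space ?\<nu>) \<noteq> \<infinity>"
      using g_int by (simp add: emeasure_density nn_integral_eq_integral)
  qed
  define U where "U = (\<integral>\<^sup>+\<xi>. ennreal (u \<xi> powr Q) \<partial>\<mu>)"
  have U_eq: "U = ennreal (LINT \<xi>|\<mu>. u \<xi> powr Q)"
    unfolding U_def using uQ_int by (intro nn_integral_eq_integral) auto
  define A where "A = (\<integral>\<^sup>+x. ennreal (norm (f x) powr (P / (P - 1))) \<partial>lborel)"
  define D where "D = ennreal (2 powr (Q * \<rho>)) * B"
  have P1: "1 < P"
  proof -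
    have "1 * 2 \<le> real n * (Q * \<rho>)" using n m by (intro mult_mono) auto
    then show ?thesis by (simp add: P)
  qed
  have F_meas [measurable]: "fourier_measure ?\<nu> \<in> borel_measurable borel"
  proof -
    interpret \<nu>: finite_measure ?\<nu> by (rule fin)
    show ?thesis unfolding fourier_measure_def[abs_def]
      by (rule \<nu>.borel_measurable_lebesgue_integral) measurable
  qed
  have swap: "(LINT \<xi>|\<mu>. complex_of_real (?g \<xi>) * fourier f \<xi>) = (LINT x|lborel. fourier_measure ?\<nu> x * f x)"
  proof -
    have "(LINT \<xi>|\<mu>. complex_of_real (?g \<xi>) * fourier f \<xi>)
        = (LINT x|lborel. (LINT \<xi>|\<mu>. complex_of_real (?g \<xi>) * cis2pi (\<xi> \<bullet> x)) * f x)"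
      unfolding fourier_eq
      by (rule integral_bounded_kernel_swap[OF sigma_finite_measure_axioms sigma_finite_lborel])
        (use f g_int in auto)
    moreover have "(LINT \<xi>|\<mu>. complex_of_real (?g \<xi>) * cis2pi (\<xi> \<bullet> x)) = fourier_measure ?\<nu> x" for x
      unfolding fourier_measure_def
      by (subst integral_density) (auto simp: scaleR_conv_of_real inner_commute)
    ultimately show ?thesis by simp
  qed
  \<comment> \<open>Where \<open>u\<close> vanishes both sides are 0, also for \<open>Q = 1\<close>,
    because \<open>0 powr 0 = 0\<close>; elsewhere \<open>u\<close> equals the real part
    itself.\<close>
  have "(LINT \<xi>|\<mu>. u \<xi> powr Q) = (LINT \<xi>|\<mu>. Re (c * (complex_of_real (?g \<xi>) * fourier f \<xi>)))"
  proof (intro Bochner_Integration.integral_cong refl)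
    fix \<xi>
    show "u \<xi> powr Q = Re (c * (complex_of_real (?g \<xi>) * fourier f \<xi>))"
    proof (cases "0 < u \<xi>")
      case True
      then have "u \<xi> = Re (c * fourier f \<xi>)" by (simp add: u_def max_def split: if_splits)
      moreover have "u \<xi> powr Q = ?g \<xi> * u \<xi>"
        using powr_add[of "u \<xi>" "Q - 1" 1] True by simp
      moreover have "Re (c * (complex_of_real (?g \<xi>) * fourier f \<xi>)) = ?g \<xi> * Re (c * fourier f \<xi>)"
        by (simp add: algebra_simps)
      ultimately show ?thesis by simp
    next
      case False
      then have "u \<xi> = 0" using u0[of \<xi>] by simp
      then show ?thesis by simp
    qed
  qed
  also have "\<dots> = Re (c * (LINT \<xi>|\<mu>. complex_of_real (?g \<xi>) * fourier f \<xi>))"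
  proof -
    have "integrable \<mu> (\<lambda>\<xi>. complex_of_real (?g \<xi>) * fourier f \<xi>)"
      by (rule integrable_const_bound[where B="M powr (Q - 1) * M"])
        (use gM norm_fourier_le[of f] in \<open>auto simp: norm_mult M_def intro!: mult_mono\<close>)
    then have "integrable \<mu> (\<lambda>\<xi>. c * (complex_of_real (?g \<xi>) * fourier f \<xi>))" by simp
    then have "(LINT \<xi>|\<mu>. Re (c * (complex_of_real (?g \<xi>) * fourier f \<xi>)))
        = Re (LINT \<xi>|\<mu>. c * (complex_of_real (?g \<xi>) * fourier f \<xi>))"
      by (rule integral_Re)
    also have "(LINT \<xi>|\<mu>. c * (complex_of_real (?g \<xi>) * fourier f \<xi>))
        = c * (LINT \<xi>|\<mu>. complex_of_real (?g \<xi>) * fourier f \<xi>)"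
      by (rule integral_mult_right_zero)
    finally show ?thesis .
  qed
  also have "\<dots> \<le> norm (c * (LINT x|lborel. fourier_measure ?\<nu> x * f x))"
    unfolding swap by (rule complex_Re_le_cmod)
  also have "\<dots> \<le> (LINT x|lborel. norm (fourier_measure ?\<nu> x * f x))"
    using integral_norm_bound[of lborel "\<lambda>x. fourier_measure ?\<nu> x * f x"] c by (simp add: norm_mult)
  finally have "U \<le> (\<integral>\<^sup>+x. ennreal (norm (fourier_measure ?\<nu> x * f x)) \<partial>lborel)"
    unfolding U_eq by (rule order_trans[OF ennreal_leI ennreal_integral_le_nn_integral]) simp
  also have "\<dots> = (\<integral>\<^sup>+x. ennreal (norm (f x)) * ennreal (norm (fourier_measure ?\<nu> x)) \<partial>lborel)"
    by (simp add: norm_mult ennreal_mult mult.commute)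
  finally have "epow P U \<le> epow P (\<integral>\<^sup>+x. ennreal (norm (f x)) * ennreal (norm (fourier_measure ?\<nu> x)) \<partial>lborel)"
    using P1 by (intro epow_mono) auto
  also have "\<dots> \<le> epow (P - 1) (\<integral>\<^sup>+x. epow (P / (P - 1)) (ennreal (norm (f x))) \<partial>lborel)
      * (\<integral>\<^sup>+x. epow P (ennreal (norm (fourier_measure ?\<nu> x))) \<partial>lborel)"
    using P1 by (intro hoelder_nn_integral) auto
  also have "\<dots> = epow (P - 1) A * (\<integral>\<^sup>+x. ennreal (norm (fourier_measure ?\<nu> x) powr (real n * (Q * \<rho>))) \<partial>lborel)"
    by (simp add: A_def P)
  also have "\<dots> \<le> epow (P - 1) A * (D * epow (\<rho> * real n * (Q - 1)) U)"
    unfolding D_def U_def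
    by (intro mult_left_mono extension_estimate[OF finite_measure_axioms \<mu>(2) n h Hh \<rho> Q m _ _ fin])
      (use u0 in auto)
  finally have le: "epow P U \<le> (D * epow (P - 1) A) * epow (\<rho> * real n * (Q - 1)) U"
    by (simp add: mult_ac)
  \<comment> \<open>Since \<open>P = real n * \<rho> + \<rho> * real n * (Q - 1)\<close>, dividing
    by the power of the finite nonzero \<open>U\<close> leaves exactly the exponent
    \<open>real n * \<rho>\<close>.\<close>
  have "epow (real n * \<rho>) U \<le> D * epow (P - 1) A"
  proof (cases "U = 0 \<or> D * epow (P - 1) A = top")
    case False
    have "U \<noteq> top" by (simp add: U_eq)
    then obtain x d where x: "U = ennreal x" "0 < x" and d: "D * epow (P - 1) A = ennreal d" "0 \<le> d"
      using False by (cases U; cases "D * epow (P - 1) A") auto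
    have "x powr P \<le> d * x powr (\<rho> * real n * (Q - 1))"
      using le x unfolding d(1) by (simp add: ennreal_mult[symmetric] d(2))
    moreover have "x powr P = x powr (real n * \<rho>) * x powr (\<rho> * real n * (Q - 1))"
      by (simp add: P algebra_simps flip: powr_add)
    ultimately have "x powr (real n * \<rho>) \<le> d" using x by simp
    then show ?thesis unfolding d(1) using x by (simp add: ennreal_leI)
  qed auto
  then show ?thesis by (simp add: U_def A_def D_def)
qed

text \<open>The four rotations produce the positive and negative parts of \<open>Re z\<close> and
  \<open>Im z\<close>; as \<open>norm z\<close> is at most the sum of their absolute values, one
  part is at least a quarter of it.\<close>

lemma norm_powr_le_sum_parts:
  fixes z :: complex
  assumes "1 \<le> Q"
  shows "norm z powr Q \<le> (\<Sum>c\<in>{1, -1, \<i>, -\<i>}. 4 powr Q * max 0 (Re (c * z)) powr Q)"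
proof -
  let ?S = "{1, -1, \<i>, -\<i>} :: complex set"
  have "\<exists>c\<in>?S. norm z \<le> 4 * max 0 (Re (c * z))"
  proof (rule ccontr)
    assume "\<not> ?thesis"
    then have "4 * Re z < norm z" "- 4 * Re z < norm z" "4 * Im z < norm z" "- 4 * Im z < norm z"
      by auto
    moreover have "norm z \<le> \<bar>Re z\<bar> + \<bar>Im z\<bar>" by (rule cmod_le)
    ultimately show False by linarith
  qed
  then obtain c where c: "c \<in> ?S" "norm z \<le> 4 * max 0 (Re (c * z))" by blast
  have "norm z powr Q \<le> (4 * max 0 (Re (c * z))) powr Q"
    using c assms by (intro powr_mono2) auto
  also have "\<dots> = 4 powr Q * max 0 (Re (c * z)) powr Q" by (simp add: powr_mult)
  also have "\<dots> \<le> (\<Sum>c\<in>?S. 4 powr Q * max 0 (Re (c * z)) powr Q)"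
    by (rule member_le_sum) (use c in auto)
  finally show ?thesis .
qed

text \<open>The bounds for the four rotated positive parts are added, after which roots are taken;
  the constant is fixed before \<open>f\<close> is chosen.\<close>

lemma restriction_estimate_endpoint:
  fixes \<mu> :: "'a::ordered_euclidean_space measure" and h :: "'a \<Rightarrow> real"
  assumes \<mu>: "prob_space \<mu>" "sets \<mu> = sets borel" and n: "1 \<le> n"
    and h: "h \<in> borel_measurable borel" "conv_power \<mu> n = density lborel (\<lambda>x. ennreal (h x))"
    and Hh: "\<And>\<psi>. \<psi> \<in> borel_measurable borel \<Longrightarrow>
      epow \<rho> (\<integral>\<^sup>+x. ennreal (h x) * \<psi> x \<partial>lborel) \<le> B * (\<integral>\<^sup>+x. epow \<rho> (\<psi> x) \<partial>lborel)"
    and B: "B < top"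
    and \<rho>: "1 \<le> \<rho>" and Q: "1 \<le> Q" and m: "2 \<le> Q * \<rho>" and P: "P = real n * (Q * \<rho>)"
  obtains C where "C < top"
    "\<And>f :: 'a \<Rightarrow> complex. integrable lborel f \<Longrightarrow>
      epow (1 / Q) (\<integral>\<^sup>+\<xi>. ennreal (norm (fourier f \<xi>) powr Q) \<partial>\<mu>)
      \<le> C * epow ((P - 1) / P) (\<integral>\<^sup>+x. ennreal (norm (f x) powr (P / (P - 1))) \<partial>lborel)"
proof
  note [measurable_cong] = \<mu>(2)
  define D where "D = ennreal (2 powr (Q * \<rho>)) * B"
  define e where "e = 1 / (real n * \<rho>)"
  \<comment> \<open>The first 4 counts the rotations, \<open>4 powr Q\<close> is the loss in
    splitting the norm, and \<open>e\<close> undoes the exponent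
    \<open>real n * \<rho>\<close>.\<close>
  define C where "C = epow (1 / Q) (ennreal (4 * 4 powr Q) * epow e D)"
  have pos: "0 < real n * \<rho>" using n \<rho> by simp
  have eQ: "1 / Q * e = 1 / P" by (simp add: e_def P)
  show "C < top"
    using B by (simp add: C_def D_def less_top[symmetric] ennreal_mult_eq_top_iff)
  fix f :: "'a \<Rightarrow> complex" assume f: "integrable lborel f"
  have [measurable]: "f \<in> borel_measurable borel" using f by auto
  let ?S = "{1, -1, \<i>, -\<i>} :: complex set"
  define A where "A = (\<integral>\<^sup>+x. ennreal (norm (f x) powr (P / (P - 1))) \<partial>lborel)"
  have part: "(\<integral>\<^sup>+\<xi>. ennreal (max 0 (Re (c * fourier f \<xi>)) powr Q) \<partial>\<mu>) \<le> epow e (D * epow (P - 1) A)"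
    if "c \<in> ?S" for c
  proof -
    have "norm c = 1" using that by auto
    then have "epow (real n * \<rho>) (\<integral>\<^sup>+\<xi>. ennreal (max 0 (Re (c * fourier f \<xi>)) powr Q) \<partial>\<mu>) \<le> D * epow (P - 1) A"
      unfolding D_def A_def
      by (intro restriction_estimate_real_part[where u = "\<lambda>\<xi>. max 0 (Re (c * fourier f \<xi>))",
            OF \<mu> n h Hh \<rho> Q m P f _ refl])
    then show ?thesis unfolding e_def epow_le_iff[OF pos] .
  qed
  have card: "card ?S = 4"
    by (simp add: card_insert_if complex_eq_iff)
  have "(\<integral>\<^sup>+\<xi>. ennreal (norm (fourier f \<xi>) powr Q) \<partial>\<mu>)
      \<le> (\<integral>\<^sup>+\<xi>. (\<Sum>c\<in>?S. ennreal (4 powr Q) * ennreal (max 0 (Re (c * fourier f \<xi>)) powr Q)) \<partial>\<mu>)"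
  proof (rule nn_integral_mono)
    fix \<xi>
    show "ennreal (norm (fourier f \<xi>) powr Q)
        \<le> (\<Sum>c\<in>?S. ennreal (4 powr Q) * ennreal (max 0 (Re (c * fourier f \<xi>)) powr Q))"
      using ennreal_leI[OF norm_powr_le_sum_parts[OF Q, of "fourier f \<xi>"]]
      by (simp only: sum_ennreal[symmetric] ennreal_mult mult_nonneg_nonneg powr_ge_zero)
  qed
  also have "\<dots> = (\<Sum>c\<in>?S. ennreal (4 powr Q) * (\<integral>\<^sup>+\<xi>. ennreal (max 0 (Re (c * fourier f \<xi>)) powr Q) \<partial>\<mu>))"
    by (rule trans[OF nn_integral_sum sum.cong[OF refl nn_integral_cmult]]; measurable)
  also have "\<dots> \<le> (\<Sum>c\<in>?S. ennreal (4 powr Q) * epow e (D * epow (P - 1) A))"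
    by (intro sum_mono mult_left_mono part) auto
  also have "\<dots> = ennreal (4 * 4 powr Q) * epow e D * epow (e * (P - 1)) A"
    unfolding sum_constant card by (simp add: ennreal_mult epow_mult epow_epow mult.assoc)
  finally have "epow (1 / Q) (\<integral>\<^sup>+\<xi>. ennreal (norm (fourier f \<xi>) powr Q) \<partial>\<mu>)
      \<le> epow (1 / Q) (ennreal (4 * 4 powr Q) * epow e D * epow (e * (P - 1)) A)"
    using Q by (intro epow_mono) auto
  also have "\<dots> = C * epow (1 / Q * (e * (P - 1))) A"
    unfolding C_def by (simp only: epow_mult epow_epow)
  also have "1 / Q * (e * (P - 1)) = (P - 1) / P"
    using eQ by (metis mult.assoc mult.commute mult_1 times_divide_eq_right)
  finally show "epow (1 / Q) (\<integral>\<^sup>+\<xi>. ennreal (norm (fourier f \<xi>) powr Q) \<partial>\<mu>)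
      \<le> C * epow ((P - 1) / P) (\<integral>\<^sup>+x. ennreal (norm (f x) powr (P / (P - 1))) \<partial>lborel)"
    unfolding A_def .
qed

section \<open>Exponents\<close>

lemma Lp_norm_ennreal:
  "0 \<le> t \<Longrightarrow> Lp_norm (ennreal t) M f = epow (1 / t) (\<integral>\<^sup>+x. ennreal (norm (f x) powr t) \<partial>M)"
  by (simp add: Lp_norm_def enn_root_eq_epow)

lemma conj_exp_ennreal:
  assumes "1 < t"
  shows "conj_exp (ennreal t) = ennreal (t / (t - 1))"
proof -
  have "1 - inverse (ennreal t) = ennreal (1 - 1 / t)"
    using assms by (simp add: inverse_ennreal inverse_eq_divide ennreal_1[symmetric] ennreal_minus del: ennreal_1)
  then have "conj_exp (ennreal t) = ennreal (inverse (1 - 1 / t))"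
    using assms by (simp add: conj_exp_def inverse_ennreal)
  also have "inverse (1 - 1 / t) = t / (t - 1)" using assms by (simp add: field_simps)
  finally show ?thesis .
qed

text \<open>Hoelder against \<open>h\<close>. For infinite \<open>r\<close> take
  \<open>\<rho> = 1\<close> and the essential supremum as \<open>B\<close>; for finite
  \<open>r\<close> take the conjugate exponent as \<open>\<rho>\<close> and for \<open>B\<close> the
  \<open>\<rho>\<close>-th power of the norm of \<open>h\<close>.\<close>

lemma in_Lp_pairing:
  fixes h :: "'a \<Rightarrow> real"
  assumes r: "1 < r" and h: "\<And>x. 0 \<le> h x" "in_Lp r M h"
  obtains \<rho> B where "1 \<le> \<rho>" "conj_exp r = ennreal \<rho>" "r \<le> 2 \<Longrightarrow> 2 \<le> \<rho>" "B < top"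
    "\<And>\<psi>. \<psi> \<in> borel_measurable M \<Longrightarrow>
      epow \<rho> (\<integral>\<^sup>+x. ennreal (h x) * \<psi> x \<partial>M) \<le> B * (\<integral>\<^sup>+x. epow \<rho> (\<psi> x) \<partial>M)"
proof (cases r)
  case top
  have [measurable]: "h \<in> borel_measurable M" using h(2) by (simp add: in_Lp_def)
  let ?B = "Lp_norm r M h"
  have AE: "AE x in M. ennreal (h x) \<le> ?B"
    using esssup_AE[of "\<lambda>x. ennreal (norm (h x))" M] h(1) top by (simp add: Lp_norm_def)
  show thesis
  proof
    show "1 \<le> (1::real)" by simp
    show "conj_exp r = ennreal 1" using top conj_exp_infinity by simp
    show "r \<le> 2 \<Longrightarrow> 2 \<le> (1::real)" using top by (simp add: top_unique)
    show "?B < top" using h(2) by (simp add: in_Lp_def)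
    show "epow 1 (\<integral>\<^sup>+x. ennreal (h x) * \<psi> x \<partial>M) \<le> ?B * (\<integral>\<^sup>+x. epow 1 (\<psi> x) \<partial>M)"
      if [measurable]: "\<psi> \<in> borel_measurable M" for \<psi>
    proof -
      have "AE x in M. ennreal (h x) * \<psi> x \<le> ?B * \<psi> x"
        using AE by eventually_elim (simp add: mult_right_mono)
      then have "(\<integral>\<^sup>+x. ennreal (h x) * \<psi> x \<partial>M) \<le> (\<integral>\<^sup>+x. ?B * \<psi> x \<partial>M)"
        by (rule nn_integral_mono_AE)
      then show ?thesis by (simp add: nn_integral_cmult)
    qed
  qed
next
  case (real t)
  then have t: "1 < t" using r by (simp add: ennreal_less_iff flip: ennreal_1)
  define \<rho> where "\<rho> = t / (t - 1)"
  have \<rho>: "1 < \<rho>" "\<rho> / (\<rho> - 1) = t" using t by (auto simp: \<rho>_def field_simps)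
  have [measurable]: "h \<in> borel_measurable M" using h(2) by (simp add: in_Lp_def)
  define X where "X = (\<integral>\<^sup>+x. ennreal (h x powr t) \<partial>M)"
  have "epow (1 / t) X < top"
    using h real t by (simp add: in_Lp_def Lp_norm_ennreal X_def)
  then have X: "X < top" by (simp add: less_top[symmetric])
  show thesis
  proof
    show "1 \<le> \<rho>" using \<rho> by simp
    show "conj_exp r = ennreal \<rho>" using real t by (simp add: conj_exp_ennreal \<rho>_def)
    show "2 \<le> \<rho>" if "r \<le> 2"
    proof -
      have "ennreal t \<le> ennreal 2" using that real by simp
      then have "t \<le> 2" by (subst (asm) ennreal_le_iff) auto
      then show ?thesis using t by (simp add: \<rho>_def field_simps)
    qed
    show "epow (\<rho> - 1) X < top" using X by (simp add: less_top[symmetric])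
    show "epow \<rho> (\<integral>\<^sup>+x. ennreal (h x) * \<psi> x \<partial>M) \<le> epow (\<rho> - 1) X * (\<integral>\<^sup>+x. epow \<rho> (\<psi> x) \<partial>M)"
      if "\<psi> \<in> borel_measurable M" for \<psi>
      using hoelder_nn_integral[OF \<rho>(1), of "\<lambda>x. ennreal (h x)" M \<psi>] that h(1)
      by (simp add: \<rho>(2) X_def)
  qed
qed

section \<open>Smaller exponents \<open>q\<close>, the case \<open>p = 1\<close>, and non-integrable
  functions\<close>

text \<open>Hoelder against the constant 1, which has norm one on a probability space; this reduces
  \<open>q\<close> to the endpoint exponent.\<close>

lemma Lp_norm_mono_exponent:
  fixes g :: "'a \<Rightarrow> 'b::{real_normed_vector, second_countable_topology}"
  assumes "prob_space M" and [measurable]: "g \<in> borel_measurable M" and st: "0 < s" "s \<le> t"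
  shows "Lp_norm (ennreal s) M g \<le> Lp_norm (ennreal t) M g"
proof (cases "s = t")
  case False
  interpret prob_space M by fact
  have m: "1 < t / s" using st False by simp
  have "epow (t / s) (\<integral>\<^sup>+x. 1 * ennreal (norm (g x) powr s) \<partial>M)
      \<le> epow (t / s - 1) (\<integral>\<^sup>+x. epow (t / s / (t / s - 1)) 1 \<partial>M) * (\<integral>\<^sup>+x. epow (t / s) (ennreal (norm (g x) powr s)) \<partial>M)"
    by (rule hoelder_nn_integral[OF m]) auto
  also have "\<dots> = (\<integral>\<^sup>+x. ennreal (norm (g x) powr t) \<partial>M)"
    using st by (simp add: emeasure_space_1 powr_powr)
  finally have "epow (1 / t) (epow (t / s) (\<integral>\<^sup>+x. ennreal (norm (g x) powr s) \<partial>M))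
      \<le> epow (1 / t) (\<integral>\<^sup>+x. ennreal (norm (g x) powr t) \<partial>M)"
    using st by (intro epow_mono) auto
  then show ?thesis using st by (simp add: Lp_norm_ennreal epow_epow)
qed simp

text \<open>Settles \<open>p = 1\<close> for every \<open>q\<close>, infinity included: the
  transform is bounded by the \<open>L^1\<close> norm and \<open>\<mu>\<close> has mass one.\<close>

lemma Lp_norm_fourier_le_L1:
  fixes f :: "'a::euclidean_space \<Rightarrow> complex"
  assumes \<mu>: "prob_space \<mu>" "sets \<mu> = sets borel" and q: "1 \<le> q" and f: "integrable lborel f"
  shows "Lp_norm q \<mu> (fourier f) \<le> Lp_norm 1 lborel f"
proof -
  interpret prob_space \<mu> by fact
  note [measurable_cong] = \<mu>(2)
  have [measurable]: "f \<in> borel_measurable borel" using f by auto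
  define M where "M = (LINT x|lborel. norm (f x))"
  have M0: "0 \<le> M" by (simp add: M_def)
  have M: "Lp_norm 1 lborel f = ennreal M"
    using Lp_norm_ennreal[of 1 lborel f] f by (simp add: M_def nn_integral_eq_integral)
  have F: "norm (fourier f \<xi>) \<le> M" for \<xi> unfolding M_def by (rule norm_fourier_le)
  show ?thesis
  proof (cases q)
    case top
    then show ?thesis
      unfolding M using F by (auto simp: Lp_norm_def intro!: esssup_I ennreal_leI)
  next
    case (real t)
    then have t: "0 < t" using q by (simp flip: ennreal_1)
    have "(\<integral>\<^sup>+\<xi>. ennreal (norm (fourier f \<xi>) powr t) \<partial>\<mu>) \<le> (\<integral>\<^sup>+\<xi>. ennreal (M powr t) \<partial>\<mu>)"
      using F t by (intro nn_integral_mono ennreal_leI powr_mono2) auto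
    then have "epow (1 / t) (\<integral>\<^sup>+\<xi>. ennreal (norm (fourier f \<xi>) powr t) \<partial>\<mu>) \<le> epow (1 / t) (ennreal (M powr t))"
      using t by (intro epow_mono) (auto simp: emeasure_space_1)
    then show ?thesis using t real M0 by (simp add: M Lp_norm_ennreal powr_powr)
  qed
qed

text \<open>The Bochner integral of a non-integrable function is \<open>0\<close>.\<close>

lemma Lp_norm_fourier_not_integrable:
  assumes "sets \<mu> = sets borel" "\<not> integrable lborel f"
  shows "Lp_norm q \<mu> (fourier f) = 0"
proof -
  have "fourier f \<xi> = 0" for \<xi>
  proof -
    have "\<not> integrable lborel (\<lambda>x. cis2pi (\<xi> \<bullet> x) * f x)"
    proof
      assume "integrable lborel (\<lambda>x. cis2pi (\<xi> \<bullet> x) * f x)"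
      \<comment> \<open>Multiplying by the opposite character recovers \<open>f\<close>.\<close>
      from integrable_cis2pi_mult[OF this, of "- \<xi>"] have "integrable lborel f"
        by (simp add: mult.assoc[symmetric] flip: cis2pi_add) (simp add: cis2pi_def)
      with assms show False by simp
    qed
    then show ?thesis unfolding fourier_eq by (rule not_integrable_integral_eq)
  qed
  then have "fourier f = (\<lambda>_. 0)" by auto
  moreover have "esssup \<mu> (\<lambda>_. 0 :: ennreal) \<le> 0" by (intro esssup_I) auto
  ultimately show ?thesis by (simp add: Lp_norm_def enn_root_eq_epow)
qed

text \<open>The case \<open>p = 1\<close> is the trivial bound. Otherwise the endpoint estimate is
  applied with \<open>Q = P / (real n * \<rho>)\<close> and the exponent lowered to
  \<open>q\<close>. This treats integrable \<open>f\<close>; for any other \<open>f\<close> the left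
  side is 0.\<close>

theorem theorem1:
  fixes \<mu> :: "(real ^ 'd) measure" and n :: nat and r p q :: ennreal
  assumes "n \<ge> 1"
    and "prob_space \<mu>" and "sets \<mu> = sets borel"
    and "1 \<le> r"
    and "has_Lp_density r (conv_power \<mu> n)"
    and "1 \<le> p"
    and "2 \<le> r \<Longrightarrow> p \<le> ennreal (2 * real n / (2 * real n - 1))"
    and "r \<le> 2 \<Longrightarrow> p \<le> (if r = 1 then 1
           else of_nat n * conj_exp r / (of_nat n * conj_exp r - 1))"
    and "1 \<le> q"
    and "q \<le> (if p = 1 then \<infinity> else conj_exp p / (of_nat n * conj_exp r))"
  shows "\<exists>C::real. C > 0 \<and>
    (\<forall>f :: real ^ 'd \<Rightarrow> complex. schwartz f \<longrightarrow>
       Lp_norm q \<mu> (fourier f) \<le> ennreal C * Lp_norm p lborel f)"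
proof -
  have "\<exists>C < top. \<forall>f :: real ^ 'd \<Rightarrow> complex. integrable lborel f \<longrightarrow>
      Lp_norm q \<mu> (fourier f) \<le> C * Lp_norm p lborel f"
  proof (cases "p = 1")
    case True
    then show ?thesis
      using Lp_norm_fourier_le_L1[OF assms(2,3,9)] by (intro exI[of _ 1]) simp
  next
    case False
    \<comment> \<open>For \<open>r = 1\<close> the upper bound on \<open>p\<close> is read as 1,
      which would force \<open>p = 1\<close>.\<close>
    have "r \<noteq> 1" using assms(6,8) False by (auto intro: antisym)
    then have r: "1 < r" using assms(4) by (simp add: order.strict_iff_order)
    obtain h :: "real ^ 'd \<Rightarrow> real" where h: "\<And>x. 0 \<le> h x" "in_Lp r lborel h"
      "conv_power \<mu> n = density lborel (\<lambda>x. ennreal (h x))"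
      using assms(5) by (auto simp: has_Lp_density_def)
    then have h_meas: "h \<in> borel_measurable borel" by (simp add: in_Lp_def)
    obtain \<rho> B where \<rho>: "1 \<le> \<rho>" "conj_exp r = ennreal \<rho>" "r \<le> 2 \<Longrightarrow> 2 \<le> \<rho>" and B: "B < top"
      and Hh: "\<And>\<psi>. \<psi> \<in> borel_measurable borel \<Longrightarrow>
        epow \<rho> (\<integral>\<^sup>+x. ennreal (h x) * \<psi> x \<partial>lborel) \<le> B * (\<integral>\<^sup>+x. epow \<rho> (\<psi> x) \<partial>lborel)"
      by (rule in_Lp_pairing[OF r h(1,2), unfolded measurable_lborel2]) (rule that)
    have n: "1 \<le> real n" using assms(1) by simp
    have n\<rho>: "of_nat n * conj_exp r = ennreal (real n * \<rho>)"
      using \<rho> by (simp add: ennreal_mult ennreal_of_nat_eq_real_of_nat)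
    have n\<rho>_pos: "0 < real n * \<rho>" using n \<rho>(1) by simp
    \<comment> \<open>Both upper bounds on \<open>p\<close> are finite; for \<open>r \<le> 2\<close>
      this uses \<open>2 \<le> real n * \<rho>\<close>, which keeps the denominator away from
      0.\<close>
    have "p \<noteq> top"
    proof (cases "2 \<le> r")
      case True
      then show ?thesis using assms(7) by (auto simp: top_unique)
    next
      case False
      then have "r \<le> 2" by simp
      then have "1 * 2 \<le> real n * \<rho>" using n \<rho>(3) by (intro mult_mono) auto
      then have "of_nat n * conj_exp r / (of_nat n * conj_exp r - 1)
          = ennreal (real n * \<rho> / (real n * \<rho> - 1))"
        unfolding n\<rho> by (simp add: ennreal_minus divide_ennreal flip: ennreal_1)
      then show ?thesis using assms(8)[OF \<open>r \<le> 2\<close>] \<open>r \<noteq> 1\<close> by (auto simp: top_unique)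
    qed
    \<comment> \<open>In the code \<open>p'\<close> and \<open>q'\<close> are the real values of
      \<open>p\<close> and \<open>q\<close>; the conjugate exponent of \<open>p\<close> is
      \<open>P\<close>.\<close>
    then obtain p' where p': "p = ennreal p'" "0 \<le> p'" by (cases p) auto
    have p1: "1 < p'"
      using False assms(6) p' by (auto simp: order.strict_iff_order simp flip: ennreal_1)
    define P where "P = p' / (p' - 1)"
    have P: "1 < P" "P / (P - 1) = p'" "(P - 1) / P = 1 / p'"
      using p1 by (auto simp: P_def field_simps)
    define Q where "Q = P / (real n * \<rho>)"
    have qQ: "q \<le> ennreal Q"
      using assms(10) False p1 n\<rho>_pos P unfolding n\<rho> p'(1)
      by (simp add: conj_exp_ennreal divide_ennreal Q_def P_def)
    then obtain q' where q': "q = ennreal q'" "0 \<le> q'" by (cases q) (auto simp: top_unique)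
    have q1: "1 \<le> q'" using assms(9) q' by (simp flip: ennreal_1)
    have q'Q: "q' \<le> Q" using qQ q' n\<rho>_pos P by (simp add: Q_def)
    then have Q1: "1 \<le> Q" using q1 by simp
    have PQ: "P = real n * (Q * \<rho>)" using n \<rho>(1) by (simp add: Q_def)
    \<comment> \<open>For \<open>2 \<le> r\<close> the bound on \<open>p\<close> says
      \<open>2 * real n \<le> P\<close>, and \<open>Q * \<rho> = P / real n\<close>. For
      \<open>r < 2\<close> already \<open>2 \<le> \<rho>\<close>, and
      \<open>1 \<le> Q\<close>.\<close>
    have m: "2 \<le> Q * \<rho>"
    proof (cases "2 \<le> r")
      case True
      then have "p' \<le> 2 * real n / (2 * real n - 1)"
        using assms(7) p' n by simp
      then have "2 * real n \<le> P" using p1 n by (simp add: P_def field_simps)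
      then show ?thesis using n unfolding PQ by simp
    next
      case False
      then have "1 * 2 \<le> Q * \<rho>" using Q1 \<rho>(3) by (intro mult_mono) auto
      then show ?thesis by simp
    qed
    obtain C where C: "C < top" "\<And>f :: real ^ 'd \<Rightarrow> complex. integrable lborel f \<Longrightarrow>
      epow (1 / Q) (\<integral>\<^sup>+\<xi>. ennreal (norm (fourier f \<xi>) powr Q) \<partial>\<mu>)
      \<le> C * epow ((P - 1) / P) (\<integral>\<^sup>+x. ennreal (norm (f x) powr (P / (P - 1))) \<partial>lborel)"
      using restriction_estimate_endpoint[OF assms(2,3,1) h_meas h(3) Hh B \<rho>(1) Q1 m PQ] by blast
    have "Lp_norm q \<mu> (fourier f) \<le> C * Lp_norm p lborel f"
      if f: "integrable lborel f" for f :: "real ^ 'd \<Rightarrow> complex"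
    proof -
      have [measurable]: "f \<in> borel_measurable borel" using f by auto
      note [measurable_cong] = assms(3)
      have "Lp_norm q \<mu> (fourier f) \<le> Lp_norm (ennreal Q) \<mu> (fourier f)"
        unfolding q'(1) using assms(2) q1 q'Q by (intro Lp_norm_mono_exponent) auto
      also have "\<dots> \<le> C * Lp_norm p lborel f"
        using C(2)[OF f] Q1 p' by (simp add: Lp_norm_ennreal P)
      finally show ?thesis .
    qed
    then show ?thesis using C(1) by blast
  qed
  then obtain C where C: "C < top" "\<And>f :: real ^ 'd \<Rightarrow> complex. integrable lborel f \<Longrightarrow>
      Lp_norm q \<mu> (fourier f) \<le> C * Lp_norm p lborel f"
    by blast
  \<comment> \<open>Adding 1 makes the constant strictly positive even if \<open>C\<close> is
    0.\<close>
  have C_le: "C \<le> ennreal (enn2real C + 1)"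
    using C(1) by (cases C) (auto intro: ennreal_leI)
  show ?thesis
  proof (intro exI[of _ "enn2real C + 1"] conjI allI impI)
    show "0 < enn2real C + 1" by (simp add: add_nonneg_pos)
    fix f :: "real ^ 'd \<Rightarrow> complex"
    show "Lp_norm q \<mu> (fourier f) \<le> ennreal (enn2real C + 1) * Lp_norm p lborel f"
    proof (cases "integrable lborel f")
      case True
      show ?thesis by (rule order_trans[OF C(2)[OF True] mult_right_mono[OF C_le]]) simp
    next
      case False
      then show ?thesis using Lp_norm_fourier_not_integrable[OF assms(3)] by simp
    qed
  qed
qed

end
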